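(* Let $m$ and $n$ be positive integers with $n$ even, $2 \leq n \leq \lfloor m/2 \rfloor - 1$, and let $f(x) = x^m + x^{n+1} + x^n + x + 1 \in \mathbb{F}_2[x]$. Suppose $m$ is odd and $n > 2$. Then $f(x)$ has an even number of irreducible factors over $\mathbb{F}_2$ if and only if one of the following conditions holds: (1) $n \equiv 0 \pmod 4$ and $m \equiv \pm 3 \pmod 8$; (2) $n \neq 6$, $n \equiv 2 \pmod 4$, and either (a) $(2m \bmod n) \leq 6$ and $m \equiv \pm 1 \pmod 8$, or (b) $(2m \bmod n) > 6$ and $m \equiv \pm 3 \pmod 8$; (3) $n = 6$, and either (c) $(2m \bmod n) = 0$ and $m \equiv \pm 3 \pmod 8$, or (d) $(2m \bmod n) \neq 0$ and $m \equiv \pm 1 \pmod 8$.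
   Context: For an integer $a$ and a positive integer $n$, $(a \bmod n)$ denotes the remainder of $a$ on division by $n$, lying in $\{0, 1, \dots, n-1\}$. $\mathbb{F}_2$ is the field with two elements. *)

theory Defs
  imports
    "HOL-Library.Z2"
    "HOL-Computational_Algebra.Computational_Algebra"
    "HOL-Computational_Algebra.Field_as_Ring"
    "HOL-Number_Theory.Cong"
begin

text \<open>
  The type \<open>bit\<close> of \<open>HOL-Library.Z2\<close> is the field with two elements. The instances below follow
  those for \<open>real\<close>, \<open>rat\<close> and \<open>complex\<close> in \<open>HOL-Computational_Algebra.Field_as_Ring\<close>; they make
  \<open>bit poly\<close> a factorial ring, so that \<open>prime_factorization\<close> is available for it.
\<close>

instantiation bit ::
  "{unique_euclidean_ring, normalization_euclidean_semiring, normalization_semidom_multiplicative}"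
begin

definition [simp]: "normalize_bit = (normalize_field :: bit \<Rightarrow> _)"
definition [simp]: "unit_factor_bit = (unit_factor_field :: bit \<Rightarrow> _)"
definition [simp]: "euclidean_size_bit = (euclidean_size_field :: bit \<Rightarrow> _)"
definition [simp]: "division_segment (x :: bit) = 1"

instance
  by standard (auto simp: dvd_field_iff)

end

instantiation bit :: euclidean_ring_gcd
begin

definition gcd_bit :: "bit \<Rightarrow> bit \<Rightarrow> bit" where
  "gcd_bit = Euclidean_Algorithm.gcd"
definition lcm_bit :: "bit \<Rightarrow> bit \<Rightarrow> bit" where
  "lcm_bit = Euclidean_Algorithm.lcm"
definition Gcd_bit :: "bit set \<Rightarrow> bit" where
 "Gcd_bit = Euclidean_Algorithm.Gcd"
definition Lcm_bit :: "bit set \<Rightarrow> bit" where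
 "Lcm_bit = Euclidean_Algorithm.Lcm"

instance by standard (simp_all add: gcd_bit_def lcm_bit_def Gcd_bit_def Lcm_bit_def)

end

instance bit :: field_gcd ..

text \<open>
  Irreducible factors are counted with multiplicity. Associated polynomials over the field with
  two elements are equal, so no choice of representatives is involved. For the polynomials
  \<open>x^m + x^(n+1) + x^n + x + 1\<close> with \<open>m\<close> odd and \<open>n\<close> even, which are squarefree, counting distinct
  factors gives the same number.
\<close>

definition num_irreducible_factors :: "bit poly \<Rightarrow> nat" where
  "num_irreducible_factors f = size (prime_factorization f)"

lemma normalize_bit_poly: "normalize (p :: bit poly) = p"
proof (cases "p = 0")
  case False
  then have "lead_coeff p = 1"
    using bit_not_zero_iff leading_coeff_neq_0 by blast
  then show ?thesis
    by (intro poly_eqI) (simp add: coeff_normalize)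
qed simp

lemma num_irreducible_factors_altdef:
  assumes "f \<noteq> 0"
  shows "num_irreducible_factors f = (\<Sum>p | irreducible p \<and> p dvd f. multiplicity p f)"
proof -
  have "prime_factors f = {p. irreducible p \<and> p dvd f}"
    using assms
    by (auto simp: prime_factors_dvd prime_def prime_elem_iff_irreducible normalize_bit_poly)
  then show ?thesis
    unfolding num_irreducible_factors_def size_multiset_overloaded_eq
    by (auto intro!: sum.cong simp: count_prime_factorization prime_def prime_elem_iff_irreducible
        normalize_bit_poly)
qed

end

theory Submission
  imports Defs
begin

text \<open>
  Let \<open>F\<close> be the pentanomial with integer coefficients, \<open>a\<^sub>1, \<dots>, a\<^sub>m\<close> its complex roots and
  \<open>\<alpha>\<^sub>1, \<dots>, \<alpha>\<^sub>m\<close> their reductions, the roots of \<open>f\<close> in a field of characteristic two.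

  The Frobenius map permutes the \<open>\<alpha>\<^sub>i\<close>, with one cycle for each irreducible factor of \<open>f\<close>, so the
  sign of this permutation tells the parity of \<open>m - r\<close>, where \<open>r\<close> is the number of factors. The
  sign can be read off from \<open>\<beta> = (\<Sum>i<j. \<alpha>\<^sub>i / (\<alpha>\<^sub>i + \<alpha>\<^sub>j))\<close>: since \<open>x / (x + y) + y / (y + x) = 1\<close>, the
  Frobenius map adds \<open>1\<close> to \<open>\<beta>\<close> for each inversion. Hence
  \<open>B = \<beta>\<^sup>2 + \<beta> = (\<Sum>i<j. \<alpha>\<^sub>i \<alpha>\<^sub>j / (\<alpha>\<^sub>i + \<alpha>\<^sub>j)\<^sup>2)\<close> lies in the prime field and equals the class of \<open>m - r\<close>.
  This is Berlekamp's form of the theorem of Stickelberger and Swan (\<open>berlekamp_parity\<close>).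

  To evaluate \<open>B\<close>, use that \<open>(x - y)\<^sup>2 = (x + y)\<^sup>2 (1 - 4 x y / (x + y)\<^sup>2)\<close>. The relation
  \<open>a^m = - (a + 1) (a^n + 1)\<close> between the roots gives \<open>F(-a) = -2 a^m / (a + 1)\<close>, and this makes the
  product of all \<open>(a\<^sub>i + a\<^sub>j)\<^sup>2\<close> with \<open>i < j\<close> equal to \<open>1\<close>. The discriminant of \<open>F\<close> is therefore
  congruent to \<open>1 - 4 B\<close> modulo \<open>8\<close>. The congruences take place in a subring of the complex numbers
  that is maximal among those not containing \<open>1/2\<close>. It is a valuation ring (Chevalley), so it
  contains the roots, and its residue field has characteristic two and receives their reductions;
  \<open>parity_from_complex_roots\<close> expresses the passage.

  The same relation turns the product of the \<open>F'(a)\<close> into a product of factors \<open>1 + 2 g(a)\<close>, where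
  \<open>g(a)\<close> is a polynomial in \<open>a\<close> and \<open>1/a\<close>. Modulo \<open>8\<close> such a product depends only on the sums of
  \<open>g(a)\<close> and \<open>g(a)\<^sup>2\<close>, hence on power sums of the inverse roots. Their generating function is
  \<open>- X F' / F\<close>; below degree \<open>2 m\<close> it is the series for \<open>(1 + X) (1 + X^n)\<close> plus one correction from
  the term \<open>X^m\<close> (\<open>power_sums_of_inverses\<close>). The exponents that survive are \<open>2 (m - n)\<close> and
  \<open>2 (m - n) - 4\<close>: whether \<open>n\<close> divides them, and the parity of two quotients by \<open>n\<close>, give the
  dependence on \<open>2 m mod n\<close>.
\<close>



section \<open>Subrings of a field that are maximal without a given inverse\<close>

locale subring_of_field =
  fixes S :: "'a :: field set"
  assumes one_closed: "1 \<in> S"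
    and diff_closed: "x \<in> S \<Longrightarrow> y \<in> S \<Longrightarrow> x - y \<in> S"
    and mult_closed: "x \<in> S \<Longrightarrow> y \<in> S \<Longrightarrow> x * y \<in> S"
begin

lemma zero_closed: "0 \<in> S"
  using diff_closed[OF one_closed one_closed] by simp

lemma uminus_closed: "x \<in> S \<Longrightarrow> - x \<in> S"
  using diff_closed[OF zero_closed] by fastforce

lemma add_closed: "x \<in> S \<Longrightarrow> y \<in> S \<Longrightarrow> x + y \<in> S"
  using diff_closed[OF _ uminus_closed, of x y] by simp

lemma power_closed: "x \<in> S \<Longrightarrow> x ^ i \<in> S"
  by (induction i) (auto intro: one_closed mult_closed)

lemma sum_closed: "(\<And>i. i \<in> A \<Longrightarrow> h i \<in> S) \<Longrightarrow> sum h A \<in> S"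
  by (induction A rule: infinite_finite_induct) (auto intro: zero_closed add_closed)

lemma sum_list_closed: "(\<And>x. x \<in> set xs \<Longrightarrow> h x \<in> S) \<Longrightarrow> sum_list (map h xs) \<in> S"
  by (induction xs) (auto intro: zero_closed add_closed)

lemma prod_list_closed: "(\<And>x. x \<in> set xs \<Longrightarrow> h x \<in> S) \<Longrightarrow> prod_list (map h xs) \<in> S"
  by (induction xs) (auto intro: one_closed mult_closed)

lemma of_nat_closed: "of_nat i \<in> S"
  by (induction i) (auto intro: zero_closed one_closed add_closed)

lemma of_int_closed: "of_int i \<in> S"
  by (cases i) (simp_all only: of_int_of_nat_eq of_int_minus of_nat_closed uminus_closed)

lemma numeral_closed: "numeral k \<in> S"
  using of_nat_closed[of "numeral k"] by simp

lemmas closed = zero_closed one_closed uminus_closed add_closed diff_closed mult_closed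
  power_closed of_nat_closed of_int_closed numeral_closed

end

definition adjoin :: "'a :: field set \<Rightarrow> 'a \<Rightarrow> 'a set" where
  "adjoin S x = {poly p x |p. \<forall>i. coeff p i \<in> S}"

lemma power_mult_inverse_power:
  "x ^ i * inverse x ^ j = inverse x ^ (j - i)" if "x \<noteq> 0" "i \<le> j" for x :: "'a :: field"
  using that by (simp add: power_diff power_inverse field_simps)

context subring_of_field
begin

lemma subring_adjoin: "subring_of_field (adjoin S x)"
proof
  have "\<forall>i. coeff 1 i \<in> S"
    by (simp add: closed)
  then show "1 \<in> adjoin S x"
    unfolding adjoin_def by (intro CollectI exI[of _ 1]) (auto simp: coeff_1)
next
  fix a b assume "a \<in> adjoin S x" "b \<in> adjoin S x"
  then obtain p q where p: "\<forall>i. coeff p i \<in> S" "a = poly p x" and q: "\<forall>i. coeff q i \<in> S" "b = poly q x"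
    unfolding adjoin_def by blast
  show "a - b \<in> adjoin S x"
    unfolding adjoin_def using p q by (intro CollectI exI[of _ "p - q"]) (auto intro: closed)
  show "a * b \<in> adjoin S x"
    unfolding adjoin_def using p q
    by (intro CollectI exI[of _ "p * q"]) (auto simp: coeff_mult intro!: sum_closed closed)
qed

lemma subset_adjoin: "S \<subseteq> adjoin S x"
proof
  fix a assume "a \<in> S"
  then show "a \<in> adjoin S x"
    unfolding adjoin_def
    by (intro CollectI exI[of _ "[:a:]"]) (auto simp: coeff_pCons closed split: nat.splits)
qed

lemma mem_adjoin: "x \<in> adjoin S x"
  unfolding adjoin_def
  by (intro CollectI exI[of _ "[:0, 1:]"]) (auto simp: coeff_pCons closed split: nat.splits)

end

text \<open>
  With \<open>t = 2\<close> in the complex numbers this is the ring in which all congruences modulo powers of two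
  are made. Maximality forces it to be a valuation ring, which is Chevalley's extension theorem.
\<close>

locale maximal_subring_avoiding = subring_of_field V for V :: "'a :: field set" +
  fixes t :: 'a
  assumes t_closed: "t \<in> V" and t_nz: "t \<noteq> 0" and avoids: "inverse t \<notin> V"
    and maximal: "subring_of_field S \<Longrightarrow> V \<subseteq> S \<Longrightarrow> inverse t \<notin> S \<Longrightarrow> S = V"
begin

lemma inverse_t_poly:
  assumes "x \<notin> V"
  shows "\<exists>p. (\<forall>i. coeff p i \<in> V) \<and> poly p x = inverse t"
proof -
  have "inverse t \<in> adjoin V x"
    using maximal[OF subring_adjoin subset_adjoin, of x] mem_adjoin[of x] assms by blast
  then show ?thesis
    unfolding adjoin_def by force
qed

text \<open>
  Otherwise the inverse would generate \<open>1/t\<close> over the ring. Clearing denominators in such a polynomial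
  expression multiplies \<open>1/t\<close> by a power of \<open>1 - t v\<close>, which is \<open>1\<close> up to a multiple of \<open>t\<close>.
\<close>
lemma unit_1_minus:
  assumes v: "v \<in> V"
  shows "1 - t * v \<noteq> 0" and "inverse (1 - t * v) \<in> V"
proof -
  define z where "z = 1 - t * v"
  have z: "z \<in> V"
    unfolding z_def using v t_closed by (intro closed)
  show nz: "1 - t * v \<noteq> 0"
  proof
    assume "1 - t * v = 0"
    then have "v = inverse t"
      using t_nz by (simp add: field_simps)
    with v avoids show False by simp
  qed
  have pow: "\<exists>w\<in>V. z ^ i = 1 - t * w" for i
  proof (induction i)
    case (Suc i)
    then obtain w where w: "w \<in> V" "z ^ i = 1 - t * w" by blast
    have "z ^ Suc i = 1 - t * (v + z * w)"
      unfolding power_Suc w(2) by (simp add: z_def algebra_simps)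
    moreover have "v + z * w \<in> V"
      using v z w by (intro closed)
    ultimately show ?case by blast
  qed (auto intro: closed)
  show "inverse (1 - t * v) \<in> V"
  proof (rule ccontr)
    assume "inverse (1 - t * v) \<notin> V"
    then obtain p where p: "\<forall>i. coeff p i \<in> V" "poly p (inverse z) = inverse t"
      using inverse_t_poly unfolding z_def by blast
    have "z ^ degree p * inverse t = z ^ degree p * poly p (inverse z)"
      using p by simp
    also have "\<dots> = (\<Sum>i\<le>degree p. coeff p i * z ^ (degree p - i))"
      unfolding poly_altdef sum_distrib_left
    proof (intro sum.cong refl)
      fix i assume "i \<in> {..degree p}"
      then show "z ^ degree p * (coeff p i * inverse z ^ i) = coeff p i * z ^ (degree p - i)"
        using power_mult_inverse_power[of "inverse z" i "degree p"] nz
        by (simp add: z_def[symmetric] mult_ac)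
    qed
    also have "\<dots> \<in> V"
      using p z by (intro sum_closed closed) auto
    finally have mem: "z ^ degree p * inverse t \<in> V" .
    obtain w where w: "w \<in> V" "z ^ degree p = 1 - t * w"
      using pow by blast
    have "inverse t = z ^ degree p * inverse t + w"
      using w t_nz by (simp add: field_simps)
    also have "\<dots> \<in> V"
      using mem w(1) by (rule add_closed)
    finally show False
      using avoids by simp
  qed
qed

text \<open>
  This is the descent in Chevalley's argument. The expression in \<open>1/x\<close>, multiplied by \<open>x^d\<close> and solved
  for \<open>x^d\<close> with the unit \<open>1 - t q\<^sub>0\<close>, lets the leading term of \<open>p\<close> be replaced by lower powers.
\<close>
lemma lower_degree:
  assumes x: "x \<noteq> 0" and xV: "x \<notin> V"
    and p: "\<forall>i. coeff p i \<in> V" "poly p x = inverse t"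
    and q: "\<forall>i. coeff q i \<in> V" "poly q (inverse x) = inverse t"
    and le: "degree q \<le> degree p"
  shows "\<exists>p'. (\<forall>i. coeff p' i \<in> V) \<and> poly p' x = inverse t \<and> degree p' < degree p"
proof -
  define d where "d = degree p"
  define e where "e = degree q"
  define u where "u = inverse (1 - t * coeff q 0)"
  have u: "u \<in> V" and nz: "1 - t * coeff q 0 \<noteq> 0"
    unfolding u_def using unit_1_minus[of "coeff q 0"] q by auto
  have d: "d > 0"
  proof (rule ccontr)
    assume "\<not> d > 0"
    then obtain c where "p = [:c:]"
      unfolding d_def using degree_eq_zeroE by blast
    then have "inverse t = coeff p 0"
      using p by simp
    with p avoids show False by metis
  qed
  have "inverse t = (\<Sum>k\<le>e. coeff q k * inverse x ^ k)"
    using q by (simp add: poly_altdef e_def)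
  also have "\<dots> = coeff q 0 + (\<Sum>k=1..e. coeff q k * inverse x ^ k)"
    by (simp add: sum.atMost_shift atLeast0AtMost sum.atLeast_Suc_atMost flip: atLeast0AtMost)
  finally have "1 = t * coeff q 0 + t * (\<Sum>k=1..e. coeff q k * inverse x ^ k)"
    using t_nz by (simp add: field_simps)
  then have "1 - t * coeff q 0 = t * (\<Sum>k=1..e. coeff q k * inverse x ^ k)"
    by (simp add: algebra_simps)
  then have "u * (1 - t * coeff q 0) = u * t * (\<Sum>k=1..e. coeff q k * inverse x ^ k)"
    by simp
  moreover have "u * (1 - t * coeff q 0) = 1"
    using nz by (simp add: u_def)
  ultimately have one: "1 = u * t * (\<Sum>k=1..e. coeff q k * inverse x ^ k)"
    by simp
  define r where "r = (\<Sum>k=1..e. monom (u * coeff q k) (d - k))"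
  have xd: "x ^ d = t * poly r x"
  proof -
    have "x ^ d = x ^ d * (u * t * (\<Sum>k=1..e. coeff q k * inverse x ^ k))"
      using one by simp
    also have "\<dots> = t * (\<Sum>k=1..e. u * coeff q k * x ^ (d - k))"
      unfolding sum_distrib_left
    proof (intro sum.cong refl)
      fix k assume "k \<in> {1..e}"
      then show "x ^ d * (u * t * (coeff q k * inverse x ^ k)) = t * (u * coeff q k * x ^ (d - k))"
        using power_mult_inverse_power[of "inverse x" k d] x le
        by (simp add: d_def e_def mult_ac)
    qed
    finally show ?thesis
      by (simp add: r_def poly_sum poly_monom)
  qed
  define p' where "p' = (p - monom (coeff p d) d) + smult (t * coeff p d) r"
  have r0: "coeff r i = 0" if "i \<ge> d" for i
    unfolding r_def coeff_sum coeff_monom using that d by (intro sum.neutral) auto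
  have "poly p' x = inverse t"
    unfolding p'_def using p xd by (simp add: poly_monom algebra_simps)
  moreover have "coeff p' i \<in> V" for i
    unfolding p'_def r_def coeff_sum coeff_monom coeff_add coeff_diff coeff_smult
    using p q u t_closed by (intro closed sum_closed) (auto intro!: closed)
  moreover have "degree p' < d"
  proof (rule degree_lessI)
    show "\<forall>k\<ge>d. coeff p' k = 0"
      using r0 by (auto simp: p'_def d_def coeff_eq_0)
  qed (use d in auto)
  ultimately show ?thesis
    unfolding d_def by blast
qed

text \<open>
  If neither \<open>x\<close> nor \<open>1/x\<close> were in the ring, each would represent \<open>1/t\<close> by a polynomial. For two
  representations of least degree, the one of larger degree could be shortened.
\<close>
lemma valuation:
  assumes x: "x \<noteq> 0" "x \<notin> V"
  shows "inverse x \<in> V"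
proof (rule ccontr)
  assume inv: "inverse x \<notin> V"
  define P where "P = (\<lambda>y p. (\<forall>i. coeff p i \<in> V) \<and> poly p y = inverse t)"
  obtain p0 q0 where "P x p0" "P (inverse x) q0"
    using inverse_t_poly[of x] inverse_t_poly[of "inverse x"] x inv by (auto simp: P_def)
  from ex_has_least_nat[of "P x", OF this(1), of degree] ex_has_least_nat[of "P (inverse x)", OF this(2), of degree]
  obtain p q where p: "P x p" "\<And>p'. P x p' \<Longrightarrow> degree p \<le> degree p'"
    and q: "P (inverse x) q" "\<And>q'. P (inverse x) q' \<Longrightarrow> degree q \<le> degree q'"
    by blast
  show False
  proof (cases "degree q \<le> degree p")
    case True
    then show False
      using lower_degree[of x p q] x p q unfolding P_def by (metis linorder_not_less)
  next
    case False
    then show False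
      using lower_degree[of "inverse x" q p] x inv p q unfolding P_def
      by (metis inverse_inverse_eq inverse_nonzero_iff_nonzero linorder_le_cases linorder_not_less)
  qed
qed

text \<open>
  If \<open>a\<close> is not in the ring then \<open>1/a\<close> is, and dividing the equation by \<open>a^(d - 1)\<close> writes \<open>a\<close> as a
  polynomial in \<open>1/a\<close>.
\<close>
lemma integral_closed:
  assumes c: "\<And>i. c i \<in> V" and a: "a ^ d = (\<Sum>i<d. c i * a ^ i)"
  shows "a \<in> V"
proof (rule ccontr)
  assume aV: "a \<notin> V"
  then have "a \<noteq> 0" using closed by auto
  then have inv: "inverse a \<in> V"
    using valuation aV by blast
  obtain e where d: "d = Suc e"
    using a by (cases d) auto
  have "a = a * (a ^ e * inverse a ^ e)"
    using \<open>a \<noteq> 0\<close> by (simp add: power_mult_inverse_power)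
  also have "\<dots> = a ^ d * inverse a ^ e"
    by (simp add: d)
  also have "\<dots> = (\<Sum>i<d. c i * inverse a ^ (e - i))"
    unfolding a sum_distrib_right using \<open>a \<noteq> 0\<close> d
    by (intro sum.cong) (auto simp: power_mult_inverse_power mult.assoc)
  also have "\<dots> \<in> V"
    using c inv by (intro sum_closed closed)
  finally show False using aV by simp
qed

definition nonunits :: "'a set" where
  "nonunits = {x \<in> V. x = 0 \<or> inverse x \<notin> V}"

lemma nonunits_closed: "x \<in> nonunits \<Longrightarrow> x \<in> V"
  by (simp add: nonunits_def)

lemma inverse_closed: "x \<in> V \<Longrightarrow> x \<notin> nonunits \<Longrightarrow> inverse x \<in> V"
  by (simp add: nonunits_def)

lemma zero_nonunit: "0 \<in> nonunits"
  by (simp add: nonunits_def closed)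

lemma one_not_nonunit: "1 \<notin> nonunits"
  by (simp add: nonunits_def closed)

lemma t_nonunit: "t \<in> nonunits"
  using avoids by (simp add: nonunits_def t_closed)

lemma mult_nonunit:
  assumes "v \<in> V" "x \<in> nonunits"
  shows "v * x \<in> nonunits"
proof (rule ccontr)
  assume *: "v * x \<notin> nonunits"
  have "v * x \<in> V"
    using assms mult_closed nonunits_closed by blast
  then have "v * x \<noteq> 0" "inverse (v * x) \<in> V"
    using * by (auto simp: nonunits_def)
  then have "v * inverse (v * x) \<in> V" "x \<noteq> 0" "v \<noteq> 0"
    using mult_closed[OF assms(1), of "inverse (v * x)"] by simp_all
  moreover from this have "v * inverse (v * x) = inverse x"
    by simp
  ultimately have "inverse x \<in> V" "x \<noteq> 0"
    by metis+
  then show False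
    using assms by (auto simp: nonunits_def)
qed

text \<open>
  One of \<open>x / y\<close> and \<open>y / x\<close> is in the ring, so that \<open>x + y\<close> is a multiple of \<open>x\<close> or of \<open>y\<close>.
\<close>
lemma add_nonunit:
  assumes "x \<in> nonunits" "y \<in> nonunits"
  shows "x + y \<in> nonunits"
proof -
  have *: "x + y \<in> nonunits" if "x \<in> nonunits" "y \<in> nonunits" "x \<noteq> 0" "inverse (y / x) \<notin> V \<or> y / x \<in> V" for x y
  proof -
    have "y / x \<in> V"
      using that valuation[of "y / x"] closed by (cases "y = 0") auto
    then have "(1 + y / x) * x \<in> nonunits"
      using that by (intro mult_nonunit closed)
    then show ?thesis
      using that by (simp add: algebra_simps)
  qed
  show ?thesis
  proof (cases "x = 0 \<or> y = 0")
    case False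
    then show ?thesis
      using *[of x y] *[of y x] assms by (auto simp: add.commute)
  qed (use assms in auto)
qed

lemma uminus_nonunit: "x \<in> nonunits \<Longrightarrow> - x \<in> nonunits"
  using mult_nonunit[OF uminus_closed[OF one_closed]] by simp

lemma diff_nonunit: "x \<in> nonunits \<Longrightarrow> y \<in> nonunits \<Longrightarrow> x - y \<in> nonunits"
  using add_nonunit[OF _ uminus_nonunit, of x y] by simp

end

theorem maximal_subring_avoiding_exists:
  assumes S0: "subring_of_field S0" and t: "t \<in> S0" "t \<noteq> 0" "inverse t \<notin> S0"
  shows "\<exists>V. S0 \<subseteq> V \<and> maximal_subring_avoiding V t"
proof -
  define \<A> where "\<A> = {S. subring_of_field S \<and> S0 \<subseteq> S \<and> inverse t \<notin> S}"
  have "\<exists>M\<in>\<A>. \<forall>X\<in>\<A>. M \<subseteq> X \<longrightarrow> X = M"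
  proof (rule subset_Zorn_nonempty)
    show "\<A> \<noteq> {}"
      using S0 t by (auto simp: \<A>_def)
  next
    fix \<C> assume ne: "\<C> \<noteq> {}" and chain: "subset.chain \<A> \<C>"
    have mem: "C \<in> \<C> \<Longrightarrow> subring_of_field C \<and> S0 \<subseteq> C \<and> inverse t \<notin> C" for C
      using chain by (auto simp: subset.chain_def \<A>_def)
    have two: "\<exists>C\<in>\<C>. x \<in> C \<and> y \<in> C" if "x \<in> \<Union>\<C>" "y \<in> \<Union>\<C>" for x y
      using that chain unfolding subset_chain_def by (metis UnionE subsetD)
    have "subring_of_field (\<Union>\<C>)"
    proof
      show "1 \<in> \<Union>\<C>"
        using ne mem subring_of_field.one_closed by blast
    next
      fix x y assume "x \<in> \<Union>\<C>" "y \<in> \<Union>\<C>"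
      then obtain C where C: "C \<in> \<C>" "x \<in> C" "y \<in> C"
        using two by blast
      then show "x - y \<in> \<Union>\<C>" "x * y \<in> \<Union>\<C>"
        using mem subring_of_field.diff_closed subring_of_field.mult_closed by blast+
    qed
    then show "\<Union>\<C> \<in> \<A>"
      using ne mem by (auto simp: \<A>_def)
  qed
  then obtain V where V: "V \<in> \<A>" "\<And>X. X \<in> \<A> \<Longrightarrow> V \<subseteq> X \<Longrightarrow> X = V"
    by blast
  then interpret subring_of_field V
    by (simp add: \<A>_def)
  have "maximal_subring_avoiding V t"
    using V t by unfold_locales (auto simp: \<A>_def)
  then show ?thesis
    using V by (auto simp: \<A>_def)
qed

section \<open>The residue field of a dyadic valuation ring\<close>

text \<open>
  The argument works with any such ring; a fixed choice is needed to make the residue field a type.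
\<close>
definition V2 :: "complex set" where
  "V2 = (SOME V. maximal_subring_avoiding V 2)"

interpretation V2: maximal_subring_avoiding V2 2
proof -
  have "subring_of_field (\<int> :: complex set)"
    by unfold_locales auto
  moreover have "inverse 2 \<notin> (\<int> :: complex set)"
  proof
    assume "inverse 2 \<in> (\<int> :: complex set)"
    then obtain i where "inverse 2 = (of_int i :: complex)"
      by (auto elim: Ints_cases)
    then have "of_int (2 * i) = (of_int 1 :: complex)"
      by (simp add: field_simps)
    then have "2 * i = 1"
      by (simp only: of_int_eq_iff)
    then show False by presburger
  qed
  ultimately have "\<exists>V :: complex set. maximal_subring_avoiding V 2"
    using maximal_subring_avoiding_exists[of \<int> "2 :: complex"] by auto
  then show "maximal_subring_avoiding V2 2"
    unfolding V2_def by (rule someI_ex)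
qed

text \<open>
  The partial quotient restricts to the valuation ring and divides by its maximal ideal at once.
\<close>

quotient_type residue = complex / partial: "\<lambda>x y. x \<in> V2 \<and> y \<in> V2 \<and> x - y \<in> V2.nonunits"
proof (rule part_equivpI)
  show "\<exists>x. x \<in> V2 \<and> x \<in> V2 \<and> x - x \<in> V2.nonunits"
    using V2.zero_closed V2.zero_nonunit by (intro exI[of _ 0]) simp
  show "symp (\<lambda>x y. x \<in> V2 \<and> y \<in> V2 \<and> x - y \<in> V2.nonunits)"
    by (rule sympI) (metis V2.uminus_nonunit minus_diff_eq)
  show "transp (\<lambda>x y. x \<in> V2 \<and> y \<in> V2 \<and> x - y \<in> V2.nonunits)"
  proof (rule transpI, safe)
    fix x y z assume "x - y \<in> V2.nonunits" "y - z \<in> V2.nonunits"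
    then show "x - z \<in> V2.nonunits"
      using V2.add_nonunit by fastforce
  qed
qed

instantiation residue :: field
begin

lift_definition zero_residue :: residue is 0
  by (simp add: V2.zero_closed V2.zero_nonunit)

lift_definition one_residue :: residue is 1
  by (simp add: V2.one_closed V2.zero_nonunit)

lift_definition plus_residue :: "residue \<Rightarrow> residue \<Rightarrow> residue" is "(+)"
  using V2.add_closed V2.add_nonunit by (metis add_diff_add)

lift_definition minus_residue :: "residue \<Rightarrow> residue \<Rightarrow> residue" is "(-)"
proof safe
  fix a b c d assume *: "a \<in> V2" "b \<in> V2" "c \<in> V2" "d \<in> V2" "a - b \<in> V2.nonunits" "c - d \<in> V2.nonunits"
  then show "a - c \<in> V2" "b - d \<in> V2"
    by (auto intro: V2.diff_closed)
  have "(a - b) - (c - d) \<in> V2.nonunits"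
    using * by (intro V2.diff_nonunit[of "a - b" "c - d"]) auto
  then show "a - c - (b - d) \<in> V2.nonunits"
    by (simp add: algebra_simps)
qed

lift_definition uminus_residue :: "residue \<Rightarrow> residue" is "uminus"
  using V2.uminus_closed V2.uminus_nonunit by (metis minus_diff_minus)

lift_definition times_residue :: "residue \<Rightarrow> residue \<Rightarrow> residue" is "(*)"
proof safe
  fix a b c d assume *: "a \<in> V2" "b \<in> V2" "c \<in> V2" "d \<in> V2" "a - b \<in> V2.nonunits" "c - d \<in> V2.nonunits"
  then show "a * c \<in> V2" "b * d \<in> V2"
    by (auto intro: V2.mult_closed)
  have "c * (a - b) + b * (c - d) \<in> V2.nonunits"
    using * by (intro V2.add_nonunit V2.mult_nonunit)
  then show "a * c - b * d \<in> V2.nonunits"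
    by (simp add: algebra_simps)
qed

lift_definition inverse_residue :: "residue \<Rightarrow> residue"
  is "\<lambda>x. if x \<in> V2.nonunits then 0 else inverse x"
proof -
  fix x y :: complex
  assume *: "x \<in> V2 \<and> y \<in> V2 \<and> x - y \<in> V2.nonunits"
  then have iff: "x \<in> V2.nonunits \<longleftrightarrow> y \<in> V2.nonunits"
    using V2.add_nonunit[of "x - y" y] V2.diff_nonunit[of x "x - y"] by auto
  show "(if x \<in> V2.nonunits then 0 else inverse x) \<in> V2 \<and>
        (if y \<in> V2.nonunits then 0 else inverse y) \<in> V2 \<and>
        (if x \<in> V2.nonunits then 0 else inverse x) - (if y \<in> V2.nonunits then 0 else inverse y) \<in> V2.nonunits"
  proof (cases "x \<in> V2.nonunits")
    case True
    then show ?thesis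
      using iff V2.zero_closed V2.zero_nonunit by simp
  next
    case False
    then have "x \<noteq> 0" "y \<noteq> 0" and inv: "inverse x \<in> V2" "inverse y \<in> V2"
      using iff * V2.zero_nonunit by (auto intro: V2.inverse_closed)
    then have "inverse x - inverse y = - (inverse x * inverse y) * (x - y)"
      by (simp add: field_simps)
    also have "\<dots> \<in> V2.nonunits"
      using * inv by (intro V2.mult_nonunit V2.closed) auto
    finally show ?thesis
      using False iff inv by simp
  qed
qed

definition divide_residue :: "residue \<Rightarrow> residue \<Rightarrow> residue" where
  "divide_residue x y = x * inverse y"

instance
proof
  fix a b c :: residue
  note [simp] = V2.closed V2.zero_nonunit
  show "a * b * c = a * (b * c)" "a * b = b * a" "1 * a = a" "a + b + c = a + (b + c)" "a + b = b + a"
    "0 + a = a" "- a + a = 0" "a - b = a + - b" "(a + b) * c = a * c + b * c"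
    by (transfer; simp add: algebra_simps)+
  show "(0 :: residue) \<noteq> 1"
    using V2.uminus_nonunit V2.one_not_nonunit by transfer force
  show "a \<noteq> 0 \<Longrightarrow> inverse a * a = 1"
  proof transfer
    fix a assume a: "a \<in> V2 \<and> a \<in> V2 \<and> a - a \<in> V2.nonunits"
      "\<not> (a \<in> V2 \<and> 0 \<in> V2 \<and> a - 0 \<in> V2.nonunits)"
    then have "a \<notin> V2.nonunits" "a \<noteq> 0"
      by auto
    then show "(if a \<in> V2.nonunits then 0 else inverse a) * a \<in> V2 \<and> 1 \<in> V2 \<and>
        (if a \<in> V2.nonunits then 0 else inverse a) * a - 1 \<in> V2.nonunits"
      by simp
  qed
  show "a div b = a * inverse b"
    by (rule divide_residue_def)
  show "inverse (0 :: residue) = 0"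
    by transfer simp
qed

end



text \<open>
  Outside the valuation ring the value \<open>0\<close> is a dummy.
\<close>

lift_definition red :: "complex \<Rightarrow> residue" is "\<lambda>x. if x \<in> V2 then x else 0"
  by (simp add: V2.closed V2.zero_nonunit)

lemma red_0 [simp]: "red 0 = 0" and red_1 [simp]: "red 1 = 1"
  by (transfer, simp add: V2.closed V2.zero_nonunit)+

lemma red_add: "x \<in> V2 \<Longrightarrow> y \<in> V2 \<Longrightarrow> red (x + y) = red x + red y"
  by transfer (simp add: V2.closed V2.zero_nonunit)

lemma red_diff: "x \<in> V2 \<Longrightarrow> y \<in> V2 \<Longrightarrow> red (x - y) = red x - red y"
  by transfer (simp add: V2.closed V2.zero_nonunit)

lemma red_mult: "x \<in> V2 \<Longrightarrow> y \<in> V2 \<Longrightarrow> red (x * y) = red x * red y"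
  by transfer (simp add: V2.closed V2.zero_nonunit)

lemma red_sum_list:
  "(\<And>x. x \<in> set xs \<Longrightarrow> h x \<in> V2) \<Longrightarrow> red (sum_list (map h xs)) = sum_list (map (\<lambda>x. red (h x)) xs)"
  by (induction xs) (auto simp: red_add V2.sum_list_closed)

lemma red_2 [simp]: "red 2 = 0"
  using V2.t_nonunit by transfer (simp add: V2.closed)

lemma red_of_nat: "red (of_nat i) = of_nat i"
  by (induction i) (auto simp: red_add V2.closed)

lemma red_inverse: "x \<in> V2 \<Longrightarrow> inverse x \<in> V2 \<Longrightarrow> x \<noteq> 0 \<Longrightarrow> red x * red (inverse x) = 1"
  by (metis red_1 red_mult right_inverse)

lemma two_residue: "(1 :: residue) + 1 = 0"
  using red_add[OF V2.one_closed V2.one_closed] by simp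


section \<open>Sums over pairs and polynomials with given roots\<close>

text \<open>
  The pairs of entries at positions \<open>i < j\<close>. The sums \<open>\<beta>\<close> and \<open>B\<close> of the introduction run over them;
  \<open>\<beta>\<close> depends on the order of the list and \<open>B\<close> does not.
\<close>
fun pairs :: "'a list \<Rightarrow> ('a \<times> 'a) list" where
  "pairs [] = []"
| "pairs (x # xs) = map (Pair x) xs @ pairs xs"

lemma length_pairs: "2 * length (pairs xs) + length xs = length xs * length xs"
  by (induction xs rule: pairs.induct) (auto simp: algebra_simps)

lemma pairs_map: "pairs (map h xs) = map (map_prod h h) (pairs xs)"
  by (induction xs) auto

lemma set_pairs: "(x, y) \<in> set (pairs xs) \<Longrightarrow> x \<in> set xs \<and> y \<in> set xs"
  by (induction xs) auto

lemma distinct_pairs: "distinct xs \<Longrightarrow> (x, y) \<in> set (pairs xs) \<Longrightarrow> x \<noteq> y"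
  by (induction xs) (auto dest: set_pairs)

lemma sum_pairs_append:
  fixes g :: "'a \<Rightarrow> 'a \<Rightarrow> 'b :: comm_monoid_add"
  shows "(\<Sum>(x, y)\<leftarrow>pairs (xs @ ys). g x y) =
    (\<Sum>(x, y)\<leftarrow>pairs xs. g x y) + (\<Sum>x\<leftarrow>xs. \<Sum>y\<leftarrow>ys. g x y) + (\<Sum>(x, y)\<leftarrow>pairs ys. g x y)"
  by (induction xs) (auto simp: o_def add_ac)

lemma map_case_prod_cong:
  "(\<And>x y. (x, y) \<in> set ps \<Longrightarrow> g x y = h x y) \<Longrightarrow>
    map (\<lambda>(x, y). g x y) ps = map (\<lambda>(x, y). h x y) ps"
  by (induction ps) auto

lemma sum_list_mset_cong:
  fixes g :: "'a \<Rightarrow> 'b :: comm_monoid_add"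
  shows "mset xs = mset ys \<Longrightarrow> (\<Sum>x\<leftarrow>xs. g x) = (\<Sum>x\<leftarrow>ys. g x)"
  by (metis mset_map sum_mset_sum_list)

lemma sum_pairs_mset_cong:
  fixes g :: "'a \<Rightarrow> 'a \<Rightarrow> 'b :: comm_monoid_add"
  assumes sym: "\<And>x y. g x y = g y x"
  shows "mset xs = mset ys \<Longrightarrow> (\<Sum>(x, y)\<leftarrow>pairs xs. g x y) = (\<Sum>(x, y)\<leftarrow>pairs ys. g x y)"
proof (induction xs arbitrary: ys)
  case (Cons x xs)
  then have "x \<in> set ys"
    by (metis list.set_intros(1) set_mset_mset)
  then obtain us vs where ys: "ys = us @ x # vs"
    by (auto dest: split_list)
  then have "mset xs = mset (us @ vs)"
    using Cons.prems by simp
  then have "(\<Sum>(x, y)\<leftarrow>pairs xs. g x y) = (\<Sum>(x, y)\<leftarrow>pairs (us @ vs). g x y)"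
    and "(\<Sum>y\<leftarrow>xs. g x y) = (\<Sum>y\<leftarrow>us @ vs. g x y)"
    by (rule Cons.IH, rule sum_list_mset_cong)
  then show ?case
    by (simp add: ys sum_pairs_append o_def sum_list_addf sym[of x] add_ac)
qed simp

definition root_poly :: "'a :: comm_ring_1 list \<Rightarrow> 'a poly" where
  "root_poly xs = (\<Prod>x\<leftarrow>xs. [:- x, 1:])"

lemma root_poly_simps [simp]:
  "root_poly [] = 1" "root_poly (x # xs) = [:- x, 1:] * root_poly xs"
  "root_poly (xs @ ys) = root_poly xs * root_poly ys"
  by (simp_all add: root_poly_def)

lemma root_poly_mset_cong: "mset xs = mset ys \<Longrightarrow> root_poly xs = root_poly ys"
  unfolding root_poly_def by (metis mset_map prod_mset_prod_list)

lemma poly_root_poly: "poly (root_poly xs) z = (\<Prod>x\<leftarrow>xs. z - x)"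
  by (induction xs) (simp_all del: mult_pCons_left)

lemma poly_root_poly_eq_0_iff:
  fixes xs :: "'a :: idom list"
  shows "poly (root_poly xs) z = 0 \<longleftrightarrow> z \<in> set xs"
  by (induction xs) (auto simp del: mult_pCons_left)

lemma root_poly_nonzero [simp]:
  fixes xs :: "'a :: idom list"
  shows "root_poly xs \<noteq> 0"
  by (induction xs) (auto simp del: mult_pCons_left)

lemma degree_root_poly [simp]:
  fixes xs :: "'a :: idom list"
  shows "degree (root_poly xs) = length xs"
  by (induction xs) (auto simp: degree_mult_eq simp del: mult_pCons_left)

lemma root_poly_dvd:
  fixes p :: "'a :: idom poly"
  shows "distinct xs \<Longrightarrow> (\<And>x. x \<in> set xs \<Longrightarrow> poly p x = 0) \<Longrightarrow> root_poly xs dvd p"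
proof (induction xs arbitrary: p)
  case (Cons x xs)
  then obtain q where q: "p = [:- x, 1:] * q"
    by (metis dvdE list.set_intros(1) poly_eq_0_iff_dvd)
  have "root_poly xs dvd q"
    using Cons by (intro Cons.IH) (auto simp: q simp del: mult_pCons_left)
  then show ?case
    by (auto simp: q simp del: mult_pCons_left)
qed simp

lemma dvd_root_poly_imp_root:
  fixes p :: "'a :: idom poly"
  shows "p dvd root_poly xs \<Longrightarrow> degree p > 0 \<Longrightarrow> \<exists>x\<in>set xs. poly p x = 0"
proof (induction xs)
  case Nil
  then obtain q where "1 = p * q" by auto
  then have "degree p + degree q = 0"
    by (metis degree_1 degree_mult_eq mult_zero_left mult_zero_right zero_neq_one)
  with Nil show ?case by simp
next
  case (Cons x xs)
  show ?case
  proof (cases "poly p x = 0")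
    case False
    from Cons.prems obtain q where q: "[:- x, 1:] * root_poly xs = p * q"
      by auto
    then have "poly (p * q) x = 0"
      by (metis mult_eq_0_iff poly_mult poly_root_poly_eq_0_iff list.set_intros(1) root_poly_simps(2))
    then have "poly q x = 0"
      using False by simp
    then obtain r where "q = [:- x, 1:] * r"
      by (metis dvdE poly_eq_0_iff_dvd)
    then have "[:- x, 1:] * root_poly xs = p * ([:- x, 1:] * r)"
      using q by argo
    then have "[:- x, 1:] * root_poly xs = [:- x, 1:] * (p * r)"
      by (simp only: mult.left_commute)
    then have "root_poly xs = p * r"
      by (subst (asm) mult_left_cancel) auto
    then show ?thesis
      using Cons by auto
  qed auto
qed

text \<open>
  The target need not have characteristic two: for the complex numbers this is the lift with
  coefficients \<open>0\<close> and \<open>1\<close>. It is a ring homomorphism in characteristic two only.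
\<close>

definition embed_poly :: "bit poly \<Rightarrow> 'a :: field poly" where
  "embed_poly p = map_poly of_bit p"

lemma coeff_embed_poly [simp]: "coeff (embed_poly p) i = of_bit (coeff p i)"
  by (simp add: embed_poly_def coeff_map_poly)

lemma embed_poly_0 [simp]: "embed_poly 0 = 0" and embed_poly_1 [simp]: "embed_poly 1 = 1"
  by (simp_all add: embed_poly_def)

lemma embed_poly_pCons [simp]: "embed_poly (pCons a p) = pCons (of_bit a) (embed_poly p)"
  by (simp add: embed_poly_def map_poly_pCons)

lemma degree_embed_poly [simp]: "degree (embed_poly p) = degree p"
  unfolding embed_poly_def by (cases "p = 0") (auto intro!: map_poly_degree_eq)

lemma embed_poly_inj: "embed_poly p = embed_poly q \<Longrightarrow> p = q"
proof (rule poly_eqI)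
  fix i
  assume "embed_poly p = (embed_poly q :: 'a poly)"
  then have "(of_bit (coeff p i) :: 'a) = of_bit (coeff q i)"
    by (metis coeff_embed_poly)
  then show "coeff p i = coeff q i"
    by (cases "coeff p i"; cases "coeff q i") auto
qed

section \<open>Berlekamp's parity formula in characteristic two\<close>

context
  assumes two: "(2 :: 'a :: field) = 0"
begin

lemma double: "x + x = (0 :: 'a)"
  using two by (metis mult_2 mult_zero_left)

lemma uminus_eq: "- x = (x :: 'a)"
  using double by (metis add_eq_0_iff)

lemma square_add: "(x + y)\<^sup>2 = x\<^sup>2 + (y\<^sup>2 :: 'a)"
  by (simp add: power2_sum two)

lemma add_eq_0_iff_eq: "x + y = 0 \<longleftrightarrow> x = (y :: 'a)"
  by (metis add_eq_0_iff uminus_eq)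

lemma square_eq_iff: "x\<^sup>2 = y\<^sup>2 \<longleftrightarrow> x = (y :: 'a)"
  by (metis add_eq_0_iff_eq power2_eq_square square_add mult_eq_0_iff)

lemma square_sum_list: "(\<Sum>x\<leftarrow>xs. h x)\<^sup>2 = (\<Sum>x\<leftarrow>xs. (h x)\<^sup>2 :: 'a)"
  by (induction xs) (auto simp: square_add)

lemma of_bit_add: "of_bit (a + b) = (of_bit a + of_bit b :: 'a)"
  by (cases a; cases b) (auto simp: two)

lemma embed_poly_add: "embed_poly (p + q) = (embed_poly p + embed_poly q :: 'a poly)"
  by (intro poly_eqI) (simp only: coeff_embed_poly coeff_add of_bit_add)

lemma embed_poly_smult: "embed_poly (smult a q) = (smult (of_bit a) (embed_poly q) :: 'a poly)"
  by (cases a) auto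

lemma embed_poly_mult: "embed_poly (p * q) = (embed_poly p * embed_poly q :: 'a poly)"
  by (induction p) (auto simp: embed_poly_add embed_poly_smult)

lemma poly_embed_square: "poly (embed_poly p) (x\<^sup>2) = (poly (embed_poly p) (x :: 'a))\<^sup>2"
proof (induction p)
  case (pCons a p)
  then show ?case
    by (cases a) (auto simp: square_add power_mult_distrib)
qed simp

lemma map_square_root_list:
  assumes "distinct as" and f: "embed_poly f = root_poly (as :: 'a list)"
  shows "mset (map (\<lambda>x. x\<^sup>2) as) = mset as"
proof -
  have inj: "inj_on (\<lambda>x :: 'a. x\<^sup>2) (set as)"
    by (rule inj_onI) (simp add: square_eq_iff)
  have "x\<^sup>2 \<in> set as" if "x \<in> set as" for x
    using that unfolding poly_root_poly_eq_0_iff[symmetric] f[symmetric] poly_embed_square by simp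
  then have "(\<lambda>x. x\<^sup>2) ` set as = set as"
    using inj by (intro endo_inj_surj) auto
  then show ?thesis
    using assms inj by (subst set_eq_iff_mset_eq_distinct[symmetric]) (auto simp: distinct_map)
qed

lemma map_poly_square_root_poly:
  "map_poly (\<lambda>x. x\<^sup>2) (root_poly xs) = root_poly (map (\<lambda>x :: 'a. x\<^sup>2) xs)"
proof (induction xs)
  case (Cons x xs)
  have "map_poly (\<lambda>x. x\<^sup>2) ([:- x, 1:] * p) = [:- x\<^sup>2, 1:] * map_poly (\<lambda>x. x\<^sup>2) p" for p :: "'a poly"
    by (intro poly_eqI)
      (auto simp: coeff_map_poly coeff_pCons square_add power_mult_distrib uminus_eq split: nat.splits)
  then show ?case
    by (simp add: Cons del: mult_pCons_left)
qed simp

text \<open>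
  The coefficients are fixed by the Frobenius map, hence roots of \<open>c\<^sup>2 = c\<close>.
\<close>
lemma root_poly_in_embed:
  assumes "mset (map (\<lambda>x. x\<^sup>2) xs) = mset (xs :: 'a list)"
  shows "\<exists>h. root_poly xs = embed_poly h"
proof -
  define h :: "bit poly" where "h = map_poly (\<lambda>c. if c = 0 then 0 else 1) (root_poly xs)"
  have "map_poly (\<lambda>x. x\<^sup>2) (root_poly xs) = root_poly xs"
    unfolding map_poly_square_root_poly by (rule root_poly_mset_cong[OF assms])
  then have "(coeff (root_poly xs) i)\<^sup>2 = coeff (root_poly xs) i" for i
    by (metis coeff_map_poly zero_power2)
  then have "coeff (root_poly xs) i = 0 \<or> coeff (root_poly xs) i = 1" for i
    by (metis mult_cancel_right1 power2_eq_square)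
  then have "coeff (root_poly xs) i = coeff (embed_poly h) i" for i
    by (force simp: h_def coeff_map_poly)
  then show ?thesis
    by (intro exI[of _ h] poly_eqI)
qed

lemma power_2_power_inj: "x ^ (2 ^ i) = y ^ (2 ^ i) \<Longrightarrow> x = (y :: 'a)"
  by (induction i arbitrary: x y) (simp_all add: power_mult, metis square_eq_iff)

text \<open>
  The Frobenius orbit of a root is closed under squaring, so its root polynomial comes from a polynomial
  \<open>h\<close> over the two-element field. As \<open>g\<close> is irreducible and shares a root with \<open>h\<close>, it divides \<open>h\<close>;
  conversely the whole orbit consists of roots of \<open>g\<close>.
\<close>
lemma irreducible_roots:
  assumes g: "irreducible g" and root: "poly (embed_poly g) (\<alpha> :: 'a) = 0"
  shows "\<exists>ws. distinct (\<alpha> # ws) \<and> embed_poly g = root_poly (\<alpha> # ws)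
    \<and> map (\<lambda>x. x\<^sup>2) (\<alpha> # ws) = ws @ [\<alpha>]"
proof -
  have "g \<noteq> 0" using g by auto
  then have nz: "embed_poly g \<noteq> (0 :: 'a poly)"
    using embed_poly_inj[of g 0] by auto
  have roots: "poly (embed_poly g) (\<alpha> ^ (2 ^ i)) = 0" for i
  proof (induction i)
    case (Suc i)
    have "\<alpha> ^ (2 ^ Suc i) = (\<alpha> ^ (2 ^ i))\<^sup>2"
      by (simp add: power_mult[symmetric] mult.commute)
    with Suc show ?case
      by (simp only: poly_embed_square) simp
  qed (simp add: root)
  have "finite (range (\<lambda>i :: nat. \<alpha> ^ (2 ^ i)))"
    by (rule finite_subset[OF _ poly_roots_finite[OF nz]]) (use roots in auto)
  then have "\<not> inj (\<lambda>i :: nat. \<alpha> ^ (2 ^ i))"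
    using finite_imageD by blast
  then obtain i j :: nat where ij: "i < j" "\<alpha> ^ (2 ^ i) = \<alpha> ^ (2 ^ j)"
    unfolding inj_def by (metis linorder_neqE_nat)
  have period: "\<alpha> ^ (2 ^ (j - i)) = \<alpha>" if "i < j" "\<alpha> ^ (2 ^ i) = \<alpha> ^ (2 ^ j)" for i j :: nat
  proof (rule power_2_power_inj[of _ i])
    have "(\<alpha> ^ (2 ^ (j - i))) ^ (2 ^ i) = \<alpha> ^ (2 ^ j)"
      using that by (simp add: power_mult[symmetric] power_add[symmetric])
    then show "(\<alpha> ^ (2 ^ (j - i))) ^ (2 ^ i) = \<alpha> ^ (2 ^ i)"
      using that by simp
  qed
  \<comment> \<open>the length of the Frobenius orbit\<close>
  define e where "e = (LEAST e. e > 0 \<and> \<alpha> ^ (2 ^ e) = \<alpha>)"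
  have e: "e > 0" "\<alpha> ^ (2 ^ e) = \<alpha>"
    using LeastI[of "\<lambda>e. e > 0 \<and> \<alpha> ^ (2 ^ e) = \<alpha>", OF conjI[OF _ period[OF ij]]] ij
    unfolding e_def by auto
  have least: "\<alpha> ^ (2 ^ i) \<noteq> \<alpha>" if "0 < i" "i < e" for i
    using not_less_Least[of i "\<lambda>e. e > 0 \<and> \<alpha> ^ (2 ^ e) = \<alpha>"] that unfolding e_def by auto
  define ws where "ws = map (\<lambda>i. \<alpha> ^ (2 ^ i)) [1..<e]"
  have xs: "\<alpha> # ws = map (\<lambda>i. \<alpha> ^ (2 ^ i)) [0..<e]"
    unfolding ws_def using e by (simp add: upt_conv_Cons)
  have "inj_on (\<lambda>i. \<alpha> ^ (2 ^ i)) {0..<e}"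
  proof (rule inj_onI, rule ccontr)
    fix i j assume *: "i \<in> {0..<e}" "j \<in> {0..<e}" "\<alpha> ^ (2 ^ i) = \<alpha> ^ (2 ^ j)" "i \<noteq> j"
    then show False
      using period[of i j] period[of j i] least[of "j - i"] least[of "i - j"]
      by (cases i j rule: linorder_cases) auto
  qed
  then have dist: "distinct (\<alpha> # ws)"
    unfolding xs by (simp add: distinct_map)
  have "map (\<lambda>x. x\<^sup>2) (\<alpha> # ws) = map (\<lambda>i. \<alpha> ^ (2 ^ i)) (map Suc [0..<e])"
    unfolding xs by (simp add: power_mult[symmetric] mult.commute)
  also have "\<dots> = ws @ [\<alpha>]"
    unfolding map_Suc_upt ws_def using e by (simp add: upt_Suc)
  finally have cycle: "map (\<lambda>x. x\<^sup>2) (\<alpha> # ws) = ws @ [\<alpha>]" .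
  then have "mset (map (\<lambda>x. x\<^sup>2) (\<alpha> # ws)) = mset (\<alpha> # ws)"
    by (simp del: list.map)
  then obtain h where h: "root_poly (\<alpha> # ws) = embed_poly h"
    using root_poly_in_embed by blast
  have h0: "poly (embed_poly h) \<alpha> = 0"
    unfolding h[symmetric] poly_root_poly_eq_0_iff by simp
  have "g dvd h"
  proof (rule ccontr)
    assume "\<not> g dvd h"
    then have "gcd g h = 1"
      using prime_elem_imp_coprime[of g h] g by (simp add: prime_elem_iff_irreducible)
    then obtain u v where "u * g + v * h = 1"
      using bezout_coefficients_fst_snd[of g h] by metis
    then have "embed_poly u * embed_poly g + embed_poly v * embed_poly h = (1 :: 'a poly)"
      by (metis embed_poly_1 embed_poly_add embed_poly_mult)
    then have "poly (embed_poly u * embed_poly g + embed_poly v * embed_poly h) \<alpha> = 1"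
      by simp
    then show False
      by (simp add: root h0)
  qed
  then obtain c where c: "h = g * c" by auto
  have "root_poly (\<alpha> # ws) dvd (embed_poly g :: 'a poly)"
    by (rule root_poly_dvd[OF dist]) (use roots xs in auto)
  then have "degree (root_poly (\<alpha> # ws)) \<le> degree (embed_poly g :: 'a poly)"
    using nz by (rule dvd_imp_degree_le)
  then have deg: "degree h \<le> degree g"
    unfolding h degree_embed_poly .
  have "h \<noteq> 0"
    using h root_poly_nonzero[of "\<alpha> # ws"] by auto
  then have "degree c = 0" "c \<noteq> 0"
    using deg c by (auto simp: degree_mult_eq)
  then have "c = 1"
    by (elim degree_eq_zeroE) (simp add: one_pCons)
  then have "embed_poly g = root_poly (\<alpha> # ws)"
    using c h by simp
  then show ?thesis
    using dist cycle by blast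
qed

lemma quotient_swap: "x \<noteq> y \<Longrightarrow> x / (x + y) + y / (y + x) = (1 :: 'a)"
  using add_eq_0_iff_eq[of x y] by (simp add: add.commute[of y x] add_divide_distrib[symmetric])

lemma artin_schreier: "x \<noteq> y \<Longrightarrow> x * y / (x + y)\<^sup>2 = (x / (x + y))\<^sup>2 + x / (x + (y :: 'a))"
proof -
  assume "x \<noteq> y"
  then have nz: "x + y \<noteq> 0" using add_eq_0_iff_eq by auto
  then have "(x / (x + y))\<^sup>2 + x / (x + y) = (x * x + x * (x + y)) / (x + y)\<^sup>2"
    by (simp add: power2_eq_square add_divide_distrib)
  also have "x * x + x * (x + y) = x * y"
    using double[of "x * x"] by (simp add: algebra_simps)
  finally show ?thesis ..
qed

lemma square_quotient: "(x / (x + y))\<^sup>2 = x\<^sup>2 / (x\<^sup>2 + (y\<^sup>2 :: 'a))"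
  by (simp add: power_divide square_add)

text \<open>
  Here \<open>\<beta>\<^sup>2\<close> is the sum \<open>\<beta>\<close> for the list rotated by one place. Only the pairs with the moved entry
  change order, and each of them changes the sum by \<open>1\<close>.
\<close>
lemma sum_pairs_cycle:
  assumes "distinct (\<alpha> # ws)" and cycle: "map (\<lambda>x. x\<^sup>2) (\<alpha> # ws) = ws @ [\<alpha>]"
  shows "(\<Sum>(x, y)\<leftarrow>pairs (\<alpha> # ws). x * y / (x + y)\<^sup>2) = (of_nat (length ws) :: 'a)"
proof -
  define \<beta> where "\<beta> = (\<Sum>(x, y)\<leftarrow>pairs (\<alpha> # ws). x / (x + y))"
  have "(\<Sum>(x, y)\<leftarrow>pairs (\<alpha> # ws). x * y / (x + y)\<^sup>2) =
      (\<Sum>(x, y)\<leftarrow>pairs (\<alpha> # ws). (x / (x + y))\<^sup>2 + x / (x + y))"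
    by (intro arg_cong[of _ _ sum_list] map_case_prod_cong artin_schreier distinct_pairs[OF assms(1)])
  also have "\<dots> = (\<Sum>(x, y)\<leftarrow>pairs (\<alpha> # ws). (x / (x + y))\<^sup>2) + \<beta>"
    unfolding \<beta>_def by (simp only: case_prod_unfold sum_list_addf)
  also have "(\<Sum>(x, y)\<leftarrow>pairs (\<alpha> # ws). (x / (x + y))\<^sup>2) =
      (\<Sum>(x, y)\<leftarrow>pairs (map (\<lambda>x. x\<^sup>2) (\<alpha> # ws)). x / (x + y))"
    unfolding pairs_map map_map by (simp only: o_def case_prod_unfold square_quotient fst_map_prod snd_map_prod)
  also have "\<dots> = (\<Sum>(x, y)\<leftarrow>pairs ws. x / (x + y)) + (\<Sum>y\<leftarrow>ws. y / (y + \<alpha>))"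
    unfolding cycle sum_pairs_append by simp
  also have "\<dots> + \<beta> = (\<Sum>(x, y)\<leftarrow>pairs ws. x / (x + y)) + (\<Sum>(x, y)\<leftarrow>pairs ws. x / (x + y))
      + (\<Sum>y\<leftarrow>ws. \<alpha> / (\<alpha> + y) + y / (y + \<alpha>))"
    unfolding \<beta>_def by (simp add: o_def sum_list_addf add_ac)
  also have "\<dots> = (\<Sum>y\<leftarrow>ws. \<alpha> / (\<alpha> + y) + y / (y + \<alpha>))"
    by (simp add: double)
  also have "\<dots> = (\<Sum>y\<leftarrow>ws. 1)"
    using assms(1) by (intro arg_cong[of _ _ sum_list] map_cong refl quotient_swap) auto
  finally show ?thesis
    by (simp add: sum_list_triv)
qed

text \<open>
  The mixed terms form \<open>\<gamma>\<^sup>2 + \<gamma>\<close> with a sum \<open>\<gamma>\<close> that is symmetric in both lists separately. The Frobenius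
  map permutes each list, so \<open>\<gamma>\<^sup>2 = \<gamma>\<close>.
\<close>
lemma sum_cross_terms:
  assumes "set xs \<inter> set ys = {}"
    and "mset (map (\<lambda>x. x\<^sup>2) xs) = mset xs" "mset (map (\<lambda>x. x\<^sup>2) ys) = mset ys"
  shows "(\<Sum>x\<leftarrow>xs. \<Sum>y\<leftarrow>ys. x * y / (x + y)\<^sup>2) = (0 :: 'a)"
proof -
  define \<gamma> where "\<gamma> = (\<Sum>x\<leftarrow>xs. \<Sum>y\<leftarrow>ys. x / (x + y))"
  have "(\<Sum>x\<leftarrow>xs. \<Sum>y\<leftarrow>ys. x * y / (x + y)\<^sup>2) = (\<Sum>x\<leftarrow>xs. \<Sum>y\<leftarrow>ys. (x / (x + y))\<^sup>2 + x / (x + y))"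
    using assms(1) by (intro arg_cong[of _ _ sum_list] map_cong refl artin_schreier) auto
  also have "\<dots> = \<gamma>\<^sup>2 + \<gamma>"
    by (simp only: \<gamma>_def square_sum_list sum_list_addf)
  also have "\<gamma>\<^sup>2 = (\<Sum>x\<leftarrow>map (\<lambda>x. x\<^sup>2) xs. \<Sum>y\<leftarrow>map (\<lambda>x. x\<^sup>2) ys. x / (x + y))"
    by (simp only: \<gamma>_def square_sum_list square_quotient map_map o_def)
  also have "\<dots> = \<gamma>"
    unfolding \<gamma>_def sum_list_mset_cong[OF assms(3)] by (rule sum_list_mset_cong[OF assms(2)])
  finally show ?thesis
    by (simp add: double)
qed

text \<open>
  A factor of degree \<open>d\<close> contributes \<open>d - 1\<close>, because its roots form a single Frobenius cycle, and the
  cross terms between different factors vanish. In characteristic two \<open>d - 1\<close> is written as \<open>d + 1\<close>.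
\<close>
lemma sum_pairs_product:
  assumes "\<And>g. g \<in> set gs \<Longrightarrow> irreducible g" and "distinct as"
    and "embed_poly (prod_list gs) = root_poly (as :: 'a list)"
  shows "(\<Sum>(x, y)\<leftarrow>pairs as. x * y / (x + y)\<^sup>2) = (of_nat (length as + length gs) :: 'a)"
  using assms
proof (induction gs arbitrary: as)
  case Nil
  then have "degree (root_poly as) = 0"
    by (metis degree_1 embed_poly_1 prod_list.Nil)
  then show ?case by simp
next
  case (Cons g gs)
  have prod: "embed_poly g * embed_poly (prod_list gs) = root_poly as"
    using Cons.prems by (simp add: embed_poly_mult)
  have g: "irreducible g"
    using Cons.prems by simp
  then have "degree (embed_poly g :: 'a poly) > 0"
    by (metis bot_nat_0.not_eq_extremum degree_embed_poly irreducible_def is_unit_iff_degree)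
  moreover have "embed_poly g dvd root_poly as"
    unfolding prod[symmetric] by (rule dvd_triv_left)
  ultimately obtain \<alpha> where "poly (embed_poly g) (\<alpha> :: 'a) = 0"
    using dvd_root_poly_imp_root by blast
  then obtain ws where ws: "distinct (\<alpha> # ws)" "embed_poly g = root_poly (\<alpha> # ws)"
      "map (\<lambda>x. x\<^sup>2) (\<alpha> # ws) = ws @ [\<alpha>]"
    using irreducible_roots[OF g] by blast
  define xs where "xs = \<alpha> # ws"
  define ys where "ys = filter (\<lambda>y. y \<notin> set xs) as"
  have "set xs \<subseteq> set as"
  proof
    fix x assume "x \<in> set xs"
    then have "poly (embed_poly g) x = 0"
      unfolding ws(2) xs_def[symmetric] poly_root_poly_eq_0_iff .
    then have "poly (root_poly as) x = 0"
      unfolding prod[symmetric] by simp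
    then show "x \<in> set as"
      unfolding poly_root_poly_eq_0_iff .
  qed
  then have "set as = set (xs @ ys)" and disj: "set xs \<inter> set ys = {}"
    by (auto simp: ys_def)
  moreover have "distinct (xs @ ys)"
    using ws(1) disj Cons.prems(2) by (auto simp: xs_def ys_def)
  ultimately have mset: "mset as = mset (xs @ ys)"
    using set_eq_iff_mset_eq_distinct[OF Cons.prems(2)] by blast
  have "root_poly xs * embed_poly (prod_list gs) = root_poly xs * root_poly ys"
    using prod unfolding root_poly_mset_cong[OF mset] ws(2) xs_def by (simp del: mult_pCons_left)
  then have rest: "embed_poly (prod_list gs) = root_poly ys"
    by (subst (asm) mult_left_cancel) auto
  have dist: "distinct ys"
    using Cons.prems(2) by (simp add: ys_def)
  have "(\<Sum>(x, y)\<leftarrow>pairs as. x * y / (x + y)\<^sup>2) = (\<Sum>(x, y)\<leftarrow>pairs (xs @ ys). x * y / (x + y)\<^sup>2)"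
    using mset by (intro sum_pairs_mset_cong) (auto simp: mult.commute add.commute)
  also have "\<dots> = of_nat (length ws) + of_nat (length ys + length gs)"
  proof -
    have "(\<Sum>x\<leftarrow>xs. \<Sum>y\<leftarrow>ys. x * y / (x + y)\<^sup>2) = 0"
      using map_square_root_list[OF ws(1,2)] map_square_root_list[OF dist rest] disj
      unfolding xs_def by (intro sum_cross_terms)
    moreover have "(\<Sum>(x, y)\<leftarrow>pairs ys. x * y / (x + y)\<^sup>2) = of_nat (length ys + length gs)"
      using Cons.prems(1) dist rest by (intro Cons.IH) auto
    ultimately show ?thesis
      unfolding sum_pairs_append sum_pairs_cycle[OF ws(1,3), folded xs_def] by simp
  qed
  also have "\<dots> = of_nat (length ws) + of_nat (length ys + length gs) + (1 + 1)"
    by (simp add: double)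
  also have "\<dots> = of_nat (length (xs @ ys) + length (g # gs))"
    by (simp add: xs_def add_ac)
  also have "length (xs @ ys) = length as"
    using mset by (metis size_mset)
  finally show ?case .
qed

theorem berlekamp_parity:
  assumes "distinct as" and f: "embed_poly f = root_poly (as :: 'a list)"
  shows "(\<Sum>(x, y)\<leftarrow>pairs as. x * y / (x + y)\<^sup>2) = (of_nat (degree f + num_irreducible_factors f) :: 'a)"
proof -
  have "f \<noteq> 0"
    using f root_poly_nonzero[of as] by auto
  obtain gs where gs: "mset gs = prime_factorization f"
    using ex_mset by blast
  have "prod_list gs = f"
    using prod_mset_prime_factorization[OF \<open>f \<noteq> 0\<close>] gs
    by (metis normalize_bit_poly prod_mset_prod_list)
  moreover have "irreducible g" if "g \<in> set gs" for g
    using that gs by (metis in_prime_factors_imp_prime prime_elem_imp_irreducible prime_imp_prime_elem set_mset_mset)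
  moreover have "length as = degree f"
    using f by (metis degree_embed_poly degree_root_poly)
  moreover have "length gs = num_irreducible_factors f"
    unfolding num_irreducible_factors_def gs[symmetric] by simp
  ultimately show ?thesis
    using sum_pairs_product[of gs as] assms by metis
qed

end


section \<open>Power sums of the inverse roots\<close>

definition power_sum_fps :: "'a :: field list \<Rightarrow> 'a fps" where
  "power_sum_fps bs = Abs_fps (\<lambda>j. if j = 0 then 0 else \<Sum>b\<leftarrow>bs. b ^ j)"

lemma fps_X_deriv_nth: "(fps_X * fps_deriv h) $ j = of_nat j * (h $ j :: 'a :: field)"
  by (cases j) auto

lemma fps_X_deriv_power: "fps_X * fps_deriv (fps_X ^ m) = (of_nat m * fps_X ^ m :: 'a :: field fps)"
  by (rule fps_ext) (simp only: fps_X_deriv_nth, simp add: fps_of_nat[symmetric] fps_X_power_nth)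

text \<open>
  These are Newton's identities: for one root both sides are \<open>b X\<close>, and the logarithmic derivative is
  additive.
\<close>
lemma newton_identity:
  fixes bs :: "'a :: field list"
  defines "P \<equiv> \<lambda>bs. \<Prod>b\<leftarrow>bs. 1 - fps_const b * fps_X"
  shows "P bs * power_sum_fps bs = - fps_X * fps_deriv (P bs)"
proof (induction bs)
  case Nil
  then show ?case by (simp add: P_def power_sum_fps_def fps_eq_iff)
next
  case (Cons b bs)
  define G where "G = Abs_fps (\<lambda>j. if j = 0 then 0 else b ^ j)"
  have G: "(1 - fps_const b * fps_X) * G = fps_const b * fps_X"
  proof (rule fps_ext)
    fix j show "((1 - fps_const b * fps_X) * G) $ j = (fps_const b * fps_X) $ j"
      by (cases j) (auto simp: G_def left_diff_distrib mult.assoc gr0_conv_Suc)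
  qed
  have split: "power_sum_fps (b # bs) = G + power_sum_fps bs"
    by (rule fps_ext) (simp add: power_sum_fps_def G_def)
  have step: "P (b # bs) = (1 - fps_const b * fps_X) * P bs"
    by (simp add: P_def)
  have "P (b # bs) * power_sum_fps (b # bs) =
      ((1 - fps_const b * fps_X) * G) * P bs + (1 - fps_const b * fps_X) * (P bs * power_sum_fps bs)"
    unfolding split step by (simp add: algebra_simps)
  also have "\<dots> = - fps_X * (fps_deriv ((1 - fps_const b * fps_X) * P bs))"
    unfolding G Cons.IH by (simp add: algebra_simps)
  finally show ?case
    by (simp add: step)
qed

text \<open>
  With \<open>P = Q + X^m\<close>, the series \<open>R' = - X Q' U - X (X^m U)'\<close> is the expansion of \<open>- X P' / P\<close> to
  first order in \<open>X^m\<close>. Multiplying by \<open>P\<close> shows that the error is divisible by \<open>X^(2 m)\<close>.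
\<close>
lemma power_sums_two_block:
  fixes Q U R :: "'a :: field fps"
  assumes U: "U * Q = 1" and R: "(Q + fps_X ^ m) * R = - fps_X * fps_deriv (Q + fps_X ^ m)"
    and Q0: "Q $ 0 = 1" and m: "m > 0" and j: "j < 2 * m"
  shows "R $ j = - (fps_X * fps_deriv Q * U) $ j - (if m \<le> j then of_nat j * U $ (j - m) else 0)"
proof -
  define P where "P = Q + fps_X ^ m"
  define R' where "R' = - fps_X * fps_deriv Q * U - fps_X * fps_deriv (fps_X ^ m * U)"
  define T where "T = of_nat m * U + fps_X * fps_deriv U"
  have XT: "fps_X * fps_deriv (fps_X ^ m * U) = fps_X ^ m * T"
  proof -
    have "fps_X * fps_deriv (fps_X ^ m * U) = fps_X * fps_deriv (fps_X ^ m) * U + fps_X ^ m * (fps_X * fps_deriv U)"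
      by (simp add: algebra_simps)
    then show ?thesis
      unfolding fps_X_deriv_power T_def by (simp add: algebra_simps)
  qed
  have QT: "Q * T = of_nat m - fps_X * fps_deriv Q * U"
  proof -
    have "fps_deriv (U * Q) = 0"
      unfolding U by simp
    then have *: "Q * fps_deriv U = - (fps_deriv Q * U)"
      by (simp add: algebra_simps eq_neg_iff_add_eq_0)
    have "Q * T = of_nat m * (U * Q) + fps_X * (Q * fps_deriv U)"
      by (simp add: T_def algebra_simps)
    then show ?thesis
      unfolding U * by (simp add: algebra_simps)
  qed
  have "P * R' = - fps_X * fps_deriv Q * (U * Q) - fps_X ^ m * (Q * T)
      - fps_X ^ m * (fps_X * fps_deriv Q * U) - fps_X ^ m * (fps_X ^ m * T)"
    unfolding P_def R'_def XT by (simp add: algebra_simps)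
  also have "\<dots> = - fps_X * fps_deriv P - fps_X ^ (2 * m) * T"
  proof -
    have "fps_X * fps_deriv P = fps_X * fps_deriv Q + of_nat m * fps_X ^ m"
      by (simp only: P_def fps_deriv_add distrib_left fps_X_deriv_power)
    moreover have "(fps_X :: 'a fps) ^ (2 * m) = fps_X ^ m * fps_X ^ m"
      by (simp add: mult_2 power_add)
    ultimately show ?thesis
      unfolding QT U mult_minus_left by (simp add: algebra_simps)
  qed
  finally have "P * (R - R') = fps_X ^ (2 * m) * T"
    using R unfolding P_def[symmetric] by (simp add: right_diff_distrib)
  moreover have "P $ 0 \<noteq> 0"
    using Q0 m by (simp add: P_def)
  ultimately have "R - R' = fps_X ^ (2 * m) * (inverse P * T)"
    by (metis (no_types, lifting) inverse_mult_eq_1 mult.assoc mult.commute mult.left_neutral)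
  then have "(R - R') $ j = 0"
    using j by (simp add: fps_X_power_mult_nth)
  then have "R $ j = R' $ j"
    by simp
  also have "\<dots> = - (fps_X * fps_deriv Q * U) $ j - of_nat j * (fps_X ^ m * U) $ j"
    unfolding R'_def fps_sub_nth fps_X_deriv_nth by simp
  finally show ?thesis
    by (simp add: fps_X_power_mult_nth)
qed

text \<open>
  The \<open>j\<close>-th power sum of the inverse roots of \<open>(1 + X) (1 + X^n)\<close> for even \<open>n\<close> and positive \<open>j\<close>: the
  number \<open>-1\<close> contributes \<open>(-1) ^ j\<close>, and the \<open>n\<close>-th roots of \<open>-1\<close> contribute the other term.
\<close>

definition psi :: "nat \<Rightarrow> nat \<Rightarrow> int" where
  "psi n j = (-1) ^ j + (if n dvd j then int n * (-1) ^ (j div n) else 0)"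

text \<open>
  The correction is \<open>j\<close> times the coefficient of \<open>X^(j - m)\<close> in \<open>1 / ((1 + X) (1 + X^n))\<close>, which is
  \<open>(-1)^t\<close> if \<open>t div n\<close> is even and \<open>0\<close> otherwise, for \<open>t = j - m\<close>.
\<close>

definition rho :: "nat \<Rightarrow> nat \<Rightarrow> nat \<Rightarrow> int" where
  "rho m n j = psi n j - (if m \<le> j \<and> even ((j - m) div n) then int j * (-1) ^ (j - m) else 0)"

lemma power_sums_of_inverses:
  fixes as :: "complex list"
  assumes F: "root_poly as = monom 1 m + monom 1 (n + 1) + monom 1 n + monom 1 1 + 1"
    and n: "even n" "n > 0" and m: "m > 0" and j: "0 < j" "j < 2 * m"
  shows "(\<Sum>a\<leftarrow>as. inverse a ^ j) = of_int (rho m n j)"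
proof -
  define Q :: "complex fps" where "Q = (1 + fps_X) * (1 + fps_X ^ n)"
  \<comment> \<open>the inverses of \<open>1 + X\<close>, of \<open>1 + X^n\<close> and of \<open>Q\<close>\<close>
  define A :: "complex fps" where "A = Abs_fps (\<lambda>t. (-1) ^ t)"
  define W :: "complex fps" where "W = Abs_fps (\<lambda>t. if n dvd t then (-1) ^ (t div n) else 0)"
  define U :: "complex fps" where "U = Abs_fps (\<lambda>t. if even (t div n) then (-1) ^ t else 0)"
  have A: "(1 + fps_X) * A = 1"
    by (rule fps_ext) (auto simp: A_def distrib_right power_eq_if)
  have block: "((1 + fps_X ^ n) * h) $ t = h $ t + (if t < n then 0 else h $ (t - n))" for h :: "complex fps" and t
    by (simp add: distrib_right fps_X_power_mult_nth)
  have W: "(1 + fps_X ^ n) * W = 1"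
  proof (rule fps_ext)
    fix t show "((1 + fps_X ^ n) * W) $ t = 1 $ t"
    proof (cases "t < n")
      case True
      then show ?thesis
        by (auto simp: block W_def dest: dvd_imp_le)
    next
      case False
      then obtain t' where "t = n + t'"
        using le_Suc_ex linorder_not_less by blast
      then show ?thesis
        using n by (simp add: block W_def)
    qed
  qed
  have "(1 + fps_X ^ n) * U = A"
  proof (rule fps_ext)
    fix t show "((1 + fps_X ^ n) * U) $ t = A $ t"
    proof (cases "t < n")
      case True
      then show ?thesis
        by (simp add: block U_def A_def)
    next
      case False
      then obtain t' where "t = n + t'"
        using le_Suc_ex linorder_not_less by blast
      then show ?thesis
        using n by (simp add: block U_def A_def power_add)
    qed
  qed
  then have QU: "U * (1 + fps_X ^ n) = A"
    by (simp only: mult.commute)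
  have "U * Q = (1 + fps_X) * (U * (1 + fps_X ^ n))"
    by (simp only: Q_def mult_ac)
  then have UQ: "U * Q = 1"
    unfolding QU A .
  have "(1 + fps_X) * U = (1 + fps_X) * U * ((1 + fps_X ^ n) * W)"
    unfolding W by simp
  also have "\<dots> = (U * Q) * W"
    by (simp only: Q_def mult_ac)
  finally have XU: "(1 + fps_X) * U = W"
    unfolding UQ by simp
  have Q': "fps_X * fps_deriv Q * U = fps_X * A + of_nat n * (fps_X ^ n * W)"
  proof -
    have "fps_X * fps_deriv Q * U = fps_X * (U * (1 + fps_X ^ n))
        + (fps_X * fps_deriv (fps_X ^ n)) * ((1 + fps_X) * U)"
      unfolding Q_def by (simp add: algebra_simps)
    then show ?thesis
      unfolding QU XU fps_X_deriv_power by (simp add: mult_ac)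
  qed
  define bs where "bs = map inverse as"
  have as0: "0 \<notin> set as"
    using poly_root_poly_eq_0_iff[of as 0] m n unfolding F by (simp add: poly_monom zero_power)
  have "poly (root_poly as) 0 = 1"
    unfolding F using m n by (simp add: poly_monom zero_power)
  then have c: "(\<Prod>a\<leftarrow>as. - a) = 1"
    by (simp add: poly_root_poly)
  have "fps_of_poly (root_poly as) = fps_const (\<Prod>a\<leftarrow>as. - a) * (\<Prod>b\<leftarrow>bs. 1 - fps_const b * fps_X)"
    using as0 unfolding bs_def
  proof (induction as)
    case (Cons a as)
    then have "fps_of_poly [:- a, 1:] = fps_const (- a) * (1 - fps_const (inverse a) * fps_X)"
      by (intro fps_ext) (simp add: coeff_pCons algebra_simps split: nat.splits)
    then show ?case
      using Cons by (simp only: root_poly_simps fps_of_poly_mult list.map prod_list.Cons fps_const_mult[symmetric])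
        (simp add: mult_ac)
  qed simp
  also have "fps_of_poly (root_poly as) = Q + fps_X ^ m"
    unfolding F Q_def by (simp add: fps_of_poly_add fps_of_poly_monom' fps_of_poly_monom algebra_simps)
  finally have P: "(\<Prod>b\<leftarrow>bs. 1 - fps_const b * fps_X) = Q + fps_X ^ m"
    unfolding c by simp
  have "power_sum_fps bs $ j = - (fps_X * fps_deriv Q * U) $ j - (if m \<le> j then of_nat j * U $ (j - m) else 0)"
  proof (rule power_sums_two_block[OF UQ _ _ m j(2)])
    show "(Q + fps_X ^ m) * power_sum_fps bs = - fps_X * fps_deriv (Q + fps_X ^ m)"
      using newton_identity[of bs] unfolding P .
    show "Q $ 0 = 1"
      using n by (simp add: Q_def fps_mult_nth)
  qed
  also have "(- (fps_X * fps_deriv Q * U)) $ j = of_int (psi n j)"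
  proof -
    have "(fps_X * A) $ j = - ((-1) ^ j)"
      using j by (cases j) (simp_all add: A_def)
    moreover have "(of_nat n * (fps_X ^ n * W)) $ j = - of_nat (if n dvd j then n else 0) * (-1) ^ (j div n)"
    proof (cases "j < n")
      case True
      then have "\<not> n dvd j"
        using j by (auto dest: dvd_imp_le)
      with True show ?thesis
        by (simp add: fps_of_nat[symmetric] fps_X_power_mult_nth)
    next
      case False
      then obtain t where "j = n + t"
        using le_Suc_ex linorder_not_less by blast
      then show ?thesis
        using n by (simp add: fps_of_nat[symmetric] fps_X_power_mult_nth W_def)
    qed
    ultimately show ?thesis
      unfolding Q' psi_def by simp
  qed
  finally show ?thesis
    using j by (simp add: power_sum_fps_def bs_def o_def rho_def U_def)
qed


section \<open>From complex roots to the parity of the number of factors\<close>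

lemma prod_list_mult: "(\<Prod>x\<leftarrow>xs. g x * h x) = (\<Prod>x\<leftarrow>xs. g x) * (\<Prod>x\<leftarrow>xs. h x :: 'a :: comm_monoid_mult)"
  by (induction xs) (simp_all add: mult_ac)

lemma prod_list_power: "(\<Prod>x\<leftarrow>xs. h x ^ i) = (\<Prod>x\<leftarrow>xs. h x :: 'a :: comm_monoid_mult) ^ i"
  by (induction xs) (simp_all add: power_mult_distrib)

lemma prod_sums_eq_square:
  fixes xs :: "'a :: comm_ring_1 list"
  shows "(\<Prod>x\<leftarrow>xs. \<Prod>y\<leftarrow>xs. x + y) = (\<Prod>x\<leftarrow>xs. 2 * x) * (\<Prod>(x, y)\<leftarrow>pairs xs. x + y)\<^sup>2"
proof (induction xs)
  case (Cons x xs)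
  define D where "D = (\<Prod>z\<leftarrow>xs. 2 * z)"
  have "(\<Prod>z\<leftarrow>xs. \<Prod>y\<leftarrow>x # xs. z + y) = (\<Prod>z\<leftarrow>xs. x + z) * (\<Prod>z\<leftarrow>xs. \<Prod>y\<leftarrow>xs. z + y)"
    by (simp add: prod_list_mult add.commute)
  then have "(\<Prod>z\<leftarrow>x # xs. \<Prod>y\<leftarrow>x # xs. z + y) =
      2 * x * (\<Prod>z\<leftarrow>xs. x + z)\<^sup>2 * (\<Prod>z\<leftarrow>xs. \<Prod>y\<leftarrow>xs. z + y)"
    by (simp add: power2_eq_square mult_ac)
  moreover have "(\<Prod>z\<leftarrow>x # xs. 2 * z) * (\<Prod>(x, y)\<leftarrow>pairs (x # xs). x + y)\<^sup>2 =
      (2 * x * D) * ((\<Prod>z\<leftarrow>xs. x + z) * (\<Prod>(x, y)\<leftarrow>pairs xs. x + y))\<^sup>2"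
    by (simp add: o_def D_def)
  ultimately show ?case
    unfolding Cons.IH D_def[symmetric] power_mult_distrib by (simp add: mult_ac del: list.map prod_list.Cons)
qed simp

lemma prod_pderiv_root_poly:
  fixes xs :: "'a :: idom list"
  shows "(\<Prod>x\<leftarrow>xs. poly (pderiv (root_poly xs)) x) = (\<Prod>(x, y)\<leftarrow>pairs xs. - ((x - y)\<^sup>2))"
proof (induction xs)
  case (Cons x xs)
  have deriv: "poly (pderiv (root_poly (x # xs))) z = poly (root_poly xs) z + (z - x) * poly (pderiv (root_poly xs)) z" for z
    unfolding root_poly_simps pderiv_mult by (simp add: pderiv_pCons algebra_simps)
  have "(\<Prod>z\<leftarrow>xs. poly (pderiv (root_poly (x # xs))) z) = (\<Prod>z\<leftarrow>xs. (z - x) * poly (pderiv (root_poly xs)) z)"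
    unfolding deriv by (intro arg_cong[of _ _ prod_list] map_cong) (simp_all add: poly_root_poly_eq_0_iff)
  then have "(\<Prod>z\<leftarrow>x # xs. poly (pderiv (root_poly (x # xs))) z) =
      (\<Prod>y\<leftarrow>xs. (x - y) * (y - x)) * (\<Prod>(x, y)\<leftarrow>pairs xs. - ((x - y)\<^sup>2))"
    by (simp only: list.map prod_list.Cons deriv[of x] poly_root_poly[of xs x] prod_list_mult Cons.IH) (simp add: mult_ac)
  also have "(\<lambda>y. (x - y) * (y - x)) = (\<lambda>y. - ((x - y)\<^sup>2))"
    by (simp add: power2_eq_square algebra_simps)
  finally show ?case
    by (simp add: o_def del: root_poly_simps)
qed simp

context subring_of_field
begin

text \<open>
  This will be applied to the terms of \<open>B\<close>. Since \<open>B\<close> is wanted modulo \<open>2\<close> only, an error \<open>8 v\<close> is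
  harmless.
\<close>
lemma prod_1_minus_4:
  "(\<And>x. x \<in> set xs \<Longrightarrow> h x \<in> S) \<Longrightarrow>
    \<exists>v\<in>S. (\<Prod>x\<leftarrow>xs. 1 - 4 * h x) = 1 - 4 * (\<Sum>x\<leftarrow>xs. h x) + 8 * v"
proof (induction xs)
  case Nil
  then show ?case by (intro bexI[of _ 0]) (auto intro: closed)
next
  case (Cons x xs)
  then obtain v where v: "v \<in> S" "(\<Prod>x\<leftarrow>xs. 1 - 4 * h x) = 1 - 4 * (\<Sum>x\<leftarrow>xs. h x) + 8 * v"
    by auto
  have "(\<Sum>x\<leftarrow>xs. h x) \<in> S" "h x \<in> S"
    using Cons.prems by (auto intro: sum_list_closed)
  then have "v + 2 * h x * (\<Sum>x\<leftarrow>xs. h x) - 4 * h x * v \<in> S"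
    using v(1) by (intro closed)
  moreover have "(\<Prod>x\<leftarrow>x # xs. 1 - 4 * h x) =
      1 - 4 * (\<Sum>x\<leftarrow>x # xs. h x) + 8 * (v + 2 * h x * (\<Sum>x\<leftarrow>xs. h x) - 4 * h x * v)"
    unfolding list.map prod_list.Cons sum_list.Cons v(2) by (simp add: algebra_simps)
  ultimately show ?case by blast
qed

text \<open>
  The second elementary symmetric function of the \<open>h x\<close> enters with factor \<open>4\<close>; twice it is the
  difference of the square of the sum and the sum of the squares. Higher ones have a factor \<open>8\<close>.
\<close>
lemma prod_1_plus_2:
  assumes mem: "\<And>x. x \<in> set xs \<Longrightarrow> h x \<in> S"
  shows "\<exists>v\<in>S. (\<Prod>x\<leftarrow>xs. 1 + 2 * h x) =
      1 + 2 * (\<Sum>x\<leftarrow>xs. h x) + 2 * ((\<Sum>x\<leftarrow>xs. h x)\<^sup>2 - (\<Sum>x\<leftarrow>xs. (h x)\<^sup>2)) + 8 * v"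
proof -
  have "\<exists>v\<in>S. \<exists>e\<in>S. (\<Sum>x\<leftarrow>xs. h x)\<^sup>2 - (\<Sum>x\<leftarrow>xs. (h x)\<^sup>2) = 2 * e \<and>
      (\<Prod>x\<leftarrow>xs. 1 + 2 * h x) = 1 + 2 * (\<Sum>x\<leftarrow>xs. h x) + 4 * e + 8 * v"
    using mem
  proof (induction xs)
    case Nil
    then show ?case by (intro bexI[of _ 0]) (auto intro: closed)
  next
    case (Cons x xs)
    then obtain v e where ve: "v \<in> S" "e \<in> S" 
      and e: "(\<Sum>x\<leftarrow>xs. h x)\<^sup>2 - (\<Sum>x\<leftarrow>xs. (h x)\<^sup>2) = 2 * e"
      and v: "(\<Prod>x\<leftarrow>xs. 1 + 2 * h x) = 1 + 2 * (\<Sum>x\<leftarrow>xs. h x) + 4 * e + 8 * v"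
      by auto
    have s: "(\<Sum>x\<leftarrow>xs. h x) \<in> S" "h x \<in> S"
      using Cons.prems by (auto intro: sum_list_closed)
    have "v + h x * e + 2 * h x * v \<in> S" "e + h x * (\<Sum>x\<leftarrow>xs. h x) \<in> S"
      using ve s by (intro closed; simp)+
    moreover have "(\<Sum>x\<leftarrow>x # xs. h x)\<^sup>2 - (\<Sum>x\<leftarrow>x # xs. (h x)\<^sup>2) = 2 * (e + h x * (\<Sum>x\<leftarrow>xs. h x))"
      using e by (simp add: power2_sum algebra_simps)
    moreover have "(\<Prod>x\<leftarrow>x # xs. 1 + 2 * h x) =
        1 + 2 * (\<Sum>x\<leftarrow>x # xs. h x) + 4 * (e + h x * (\<Sum>x\<leftarrow>xs. h x)) + 8 * (v + h x * e + 2 * h x * v)"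
      unfolding list.map prod_list.Cons sum_list.Cons v by (simp add: algebra_simps)
    ultimately show ?case by blast
  qed
  then obtain v e where "v \<in> S" and e: "(\<Sum>x\<leftarrow>xs. h x)\<^sup>2 - (\<Sum>x\<leftarrow>xs. (h x)\<^sup>2) = 2 * e"
    and v: "(\<Prod>x\<leftarrow>xs. 1 + 2 * h x) = 1 + 2 * (\<Sum>x\<leftarrow>xs. h x) + 4 * e + 8 * v"
    by blast
  then show ?thesis
    unfolding v e by (intro bexI[of _ v]) simp_all
qed

text \<open>
  The inverse of one factor is, up to sign, the product of the others.
\<close>
lemma inverse_closed_of_prod:
  assumes "\<And>x. x \<in> set xs \<Longrightarrow> h x \<in> S" and "(\<Prod>x\<leftarrow>xs. h x)\<^sup>2 = 1" and x: "x \<in> set xs"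
  shows "inverse (h x) \<in> S" and "h x \<noteq> 0"
proof -
  obtain us vs where xs: "xs = us @ x # vs"
    using x by (auto dest: split_list)
  define w where "w = (\<Prod>x\<leftarrow>us @ vs. h x)"
  have w: "(\<Prod>x\<leftarrow>xs. h x) = h x * w"
    by (simp add: xs w_def mult_ac)
  have "w \<in> S" "(\<Prod>x\<leftarrow>xs. h x) \<in> S"
    unfolding w_def using assms(1) by (intro prod_list_closed; auto simp: xs)+
  then have mem: "w * (\<Prod>x\<leftarrow>xs. h x) \<in> S"
    by (rule mult_closed)
  have eq: "h x * (w * (\<Prod>x\<leftarrow>xs. h x)) = 1"
    using assms(2) unfolding w by (simp add: power2_eq_square mult_ac)
  then show "h x \<noteq> 0" by auto
  show "inverse (h x) \<in> S"
    using mem inverse_unique[OF eq] by simp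
qed

lemma coeff_root_poly_closed: "set xs \<subseteq> S \<Longrightarrow> coeff (root_poly xs) i \<in> S"
  by (induction xs arbitrary: i)
    (auto simp: coeff_pCons coeff_1 intro!: closed split: nat.splits)

end

lemma red_of_int: "red (of_int c) = of_bool (odd c)"
proof (cases "even c")
  case True
  then obtain d where "c = 2 * d" by auto
  then show ?thesis
    using red_mult[of 2 "of_int d"] by (simp add: V2.closed)
next
  case False
  then obtain d where "c = 2 * d + 1" by (auto elim: oddE)
  then show ?thesis
    using red_mult[of 2 "of_int d"] red_add[of "2 * of_int d" 1] by (simp add: V2.closed)
qed

lemma of_nat_residue: "(of_nat i :: residue) = of_bool (odd i)"
  using red_of_nat[of i] red_of_int[of "int i"] by simp

lemma map_poly_red_root_poly:
  "set as \<subseteq> V2 \<Longrightarrow> map_poly red (root_poly as) = root_poly (map red as)"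
proof (induction as)
  case (Cons a as)
  have "map_poly red ([:- a, 1:] * p) = [:- red a, 1:] * map_poly red p" if "\<And>i. coeff p i \<in> V2" for p
    using that Cons.prems
    by (intro poly_eqI)
      (auto simp: coeff_map_poly coeff_pCons red_add red_diff red_mult V2.closed split: nat.splits)
  then show ?case
    using Cons V2.coeff_root_poly_closed[of as] by (simp del: mult_pCons_left)
qed simp

lemma map_poly_red_embed_poly: "map_poly red (embed_poly f) = embed_poly f"
  by (intro poly_eqI) (simp add: coeff_map_poly)

lemma distinct_of_pairs: "\<forall>(x, y)\<in>set (pairs xs). x \<noteq> y \<Longrightarrow> distinct xs"
  by (induction xs) auto

text \<open>
  Reducing the complex sum gives the sum of Berlekamp's formula for the reduced roots. That \<open>x + y\<close> is a
  unit also makes the reductions distinct, since \<open>x + y\<close> and \<open>x - y\<close> agree modulo \<open>2\<close>.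
\<close>
theorem parity_from_complex_roots:
  fixes c :: int
  assumes f: "embed_poly f = root_poly as" and as: "set as \<subseteq> V2"
    and units: "\<And>x y. (x, y) \<in> set (pairs as) \<Longrightarrow> x + y \<noteq> 0 \<and> inverse (x + y) \<in> V2"
    and c: "(\<Sum>(x, y)\<leftarrow>pairs as. x * y / (x + y)\<^sup>2) = of_int c + 2 * v" and v: "v \<in> V2"
  shows "even (degree f + num_irreducible_factors f) \<longleftrightarrow> even c"
proof -
  have two: "(2 :: residue) = 0"
    using two_residue by simp
  have V: "x \<in> V2" "y \<in> V2" if "(x, y) \<in> set (pairs as)" for x y
    using set_pairs[OF that] as by auto
  have sum_unit: "red x + red y \<noteq> 0" and inv: "red (inverse (x + y)) = inverse (red x + red y)"
    if "(x, y) \<in> set (pairs as)" for x y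
  proof -
    have "red (x + y) * red (inverse (x + y)) = 1"
      using units[OF that] V[OF that] by (intro red_inverse V2.closed) auto
    then have "(red x + red y) * red (inverse (x + y)) = 1"
      using V[OF that] by (simp add: red_add)
    then show "red x + red y \<noteq> 0" "red (inverse (x + y)) = inverse (red x + red y)"
      by (auto simp: inverse_unique)
  qed
  have dist: "distinct (map red as)"
  proof (rule distinct_of_pairs, clarify)
    fix x y :: residue assume "(x, x) \<in> set (pairs (map red as))"
    then obtain x' y' where "(x', y') \<in> set (pairs as)" "x = red x'" "x = red y'"
      by (auto simp: pairs_map)
    then show False
      using sum_unit[of x' y'] double[OF two, of x] by simp
  qed
  have mem: "x * y / (x + y)\<^sup>2 \<in> V2" if "(x, y) \<in> set (pairs as)" for x y
    using V[OF that] units[OF that]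
    by (simp add: divide_inverse power_inverse[symmetric]) (intro V2.closed; simp)
  have quot: "red (x * y / (x + y)\<^sup>2) = red x * red y / (red x + red y)\<^sup>2" if "(x, y) \<in> set (pairs as)" for x y
  proof -
    have "x * y / (x + y)\<^sup>2 = (x * y) * (inverse (x + y) * inverse (x + y))"
      by (simp add: divide_inverse power2_eq_square)
    also have "red \<dots> = (red x * red y) * (inverse (red x + red y) * inverse (red x + red y))"
      using V[OF that] units[OF that] by (simp add: red_mult V2.mult_closed inv[OF that])
    finally show ?thesis
      by (simp add: divide_inverse power2_eq_square)
  qed
  have "of_nat (degree f + num_irreducible_factors f) =
      (\<Sum>(x, y)\<leftarrow>pairs (map red as). x * y / (x + y)\<^sup>2)"
    using map_poly_red_root_poly[OF as] f map_poly_red_embed_poly[of f]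
    by (intro berlekamp_parity[OF two dist, symmetric]) simp
  also have "\<dots> = (\<Sum>(x, y)\<leftarrow>pairs as. red x * red y / (red x + red y)\<^sup>2)"
    by (simp add: pairs_map o_def case_prod_unfold)
  also have "\<dots> = (\<Sum>(x, y)\<leftarrow>pairs as. red (x * y / (x + y)\<^sup>2))"
    by (intro arg_cong[of _ _ sum_list] map_case_prod_cong) (simp add: quot)
  also have "\<dots> = red (\<Sum>(x, y)\<leftarrow>pairs as. x * y / (x + y)\<^sup>2)"
    using red_sum_list[of "pairs as" "\<lambda>(x, y). x * y / (x + y)\<^sup>2"] mem
    by (simp add: case_prod_unfold)
  also have "\<dots> = of_bool (odd c)"
    unfolding c using v by (simp add: red_add red_mult red_of_int V2.closed)
  finally show ?thesis
    unfolding of_nat_residue by (auto split: if_splits)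
qed


section \<open>The discriminant of the pentanomial modulo 8\<close>

text \<open>
  The exponents \<open>m - n - 3, \<dots>, m - n\<close> of the inverse roots will occur, so \<open>M = m - n - 3\<close> is used to
  avoid subtractions. The condition \<open>n \<le> M\<close> is the bound \<open>n \<le> m div 2 - 1\<close> for odd \<open>m\<close>.
\<close>
locale pentanomial_roots =
  fixes m n k l M :: nat and as :: "complex list"
  assumes m_eq: "m = 2 * k + 1" and n_eq: "n = 2 * l" and M_eq: "m = n + M + 3" and n_le: "n \<le> M" and n_pos: "n > 0"
    and F: "root_poly as = monom 1 m + monom 1 (n + 1) + monom 1 n + monom 1 1 + 1"
begin

lemma poly_F: "poly (root_poly as) z = z ^ m + (z + 1) * (z ^ n + 1)"
  unfolding F by (simp add: poly_monom algebra_simps)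

lemma root_iff: "a \<in> set as \<longleftrightarrow> a ^ m + (a + 1) * (a ^ n + 1) = 0"
  unfolding poly_root_poly_eq_0_iff[symmetric] poly_F ..

lemma length_as: "length as = m"
proof -
  have "degree (monom 1 (n + 1) + monom 1 n + monom 1 1 + (1 :: complex poly)) < m"
    using M_eq n_le n_pos by (intro degree_add_less) (auto simp: degree_monom_eq)
  then have "degree (monom 1 m + (monom 1 (n + 1) + monom 1 n + monom 1 1 + (1 :: complex poly))) = m"
    by (subst degree_add_eq_left) (auto simp: degree_monom_eq)
  then show ?thesis
    unfolding degree_root_poly[symmetric] F by (simp add: add.assoc)
qed

lemma root_nz: "a \<in> set as \<Longrightarrow> a \<noteq> 0" "a \<in> set as \<Longrightarrow> a + 1 \<noteq> 0"
proof -
  assume a: "a \<in> set as"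
  show "a \<noteq> 0"
    using a M_eq n_pos unfolding root_iff by (auto simp: zero_power)
  show "a + 1 \<noteq> 0"
  proof
    assume "a + 1 = 0"
    then have "a ^ m = 0"
      using a unfolding root_iff by simp
    with \<open>a + 1 = 0\<close> show False by simp
  qed
qed

lemma prod_diff: "(\<Prod>a\<leftarrow>as. z - a) = z ^ m + (z + 1) * (z ^ n + 1)"
  unfolding poly_F[symmetric] poly_root_poly ..

lemma prod_neg: "(\<Prod>a\<leftarrow>as. - h a) = - (\<Prod>a\<leftarrow>as. h a :: complex)"
proof -
  have "(\<Prod>a\<leftarrow>as. - 1 * h a) = (-1) ^ m * (\<Prod>a\<leftarrow>as. h a)"
    unfolding prod_list_mult by (simp add: length_as map_replicate_const)
  then show ?thesis
    using m_eq by simp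
qed

lemma prod_roots: "(\<Prod>a\<leftarrow>as. a) = -1" and prod_roots_plus_1: "(\<Prod>a\<leftarrow>as. a + 1) = 1"
proof -
  have "(\<Prod>a\<leftarrow>as. - a) = 1"
    using prod_diff[of 0] n_pos M_eq by (simp add: zero_power)
  then show "(\<Prod>a\<leftarrow>as. a) = -1"
    unfolding prod_neg by (simp add: minus_equation_iff)
  have "(\<lambda>a. -1 - a) = (\<lambda>a :: complex. - (a + 1))"
    by (simp add: fun_eq_iff)
  then have "(\<Prod>a\<leftarrow>as. - (a + 1)) = -1"
    using prod_diff[of "-1"] m_eq by simp
  then show "(\<Prod>a\<leftarrow>as. a + 1) = 1"
    unfolding prod_neg by (simp add: minus_equation_iff)
qed

text \<open>
  For a root \<open>x\<close>, the product of all \<open>x + y\<close> is \<open>- F(-x)\<close>, and the relation \<open>x^m = - (x + 1) (x^n + 1)\<close>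
  turns this into \<open>2 x^m / (x + 1)\<close>. The factors \<open>2 x\<close> come from the diagonal, and the rest multiplies
  to \<open>1\<close> because the products of the \<open>x\<close> and of the \<open>x + 1\<close> are \<open>-1\<close> and \<open>1\<close>.
\<close>
lemma prod_pair_sums: "(\<Prod>(x, y)\<leftarrow>pairs as. x + y)\<^sup>2 = 1"
proof -
  have inner: "(\<Prod>y\<leftarrow>as. x + y) * (x + 1) = 2 * x ^ m" if "x \<in> set as" for x
  proof -
    have "(\<lambda>a. - x - a) = (\<lambda>a. - (x + a))"
      by (simp add: fun_eq_iff)
    then have "- (\<Prod>y\<leftarrow>as. x + y) = - (x ^ m) + (1 - x) * (x ^ n + 1)"
      using prod_diff[of "- x"] m_eq n_eq unfolding prod_neg[symmetric] by simp
    moreover have "x ^ m + (x + 1) * (x ^ n + 1) = 0"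
      using that unfolding root_iff .
    moreover have "p * (x + 1) = 2 * u" if "- p = - u + (1 - x) * (w + 1)" "u + (x + 1) * (w + 1) = 0" for p u w
      using that by algebra
    ultimately show ?thesis
      by blast
  qed
  have "(\<Prod>x\<leftarrow>as. (\<Prod>y\<leftarrow>as. x + y) * (x + 1)) = (\<Prod>x\<leftarrow>as. 2 * x ^ m)"
    using inner by (intro arg_cong[of _ _ prod_list] map_cong) auto
  then have "(\<Prod>x\<leftarrow>as. \<Prod>y\<leftarrow>as. x + y) = (\<Prod>x\<leftarrow>as. 2) * (\<Prod>x\<leftarrow>as. x) ^ m"
    unfolding prod_list_mult prod_list_power prod_roots_plus_1 by simp
  also have "(\<Prod>x\<leftarrow>as. x) ^ m = (\<Prod>x\<leftarrow>as. x)"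
    unfolding prod_roots using m_eq by simp
  finally have "(\<Prod>x\<leftarrow>as. \<Prod>y\<leftarrow>as. x + y) = (\<Prod>x\<leftarrow>as. 2 * x)"
    unfolding prod_list_mult .
  moreover have "(\<Prod>x\<leftarrow>as. 2 * x) \<noteq> 0"
    using root_nz by (auto simp: prod_list_zero_iff)
  ultimately show ?thesis
    unfolding prod_sums_eq_square by simp
qed

text \<open>
  Up to the factor \<open>a^m / (a (a + 1))\<close>, the derivative at a root is
  \<open>m + (m - 1) a + n (a + 1)\<^sup>2 / a^(m - n)\<close>; this is \<open>1 + 2 g a\<close> for \<open>m = 2 k + 1\<close> and \<open>n = 2 l\<close>.
\<close>
definition g :: "complex \<Rightarrow> complex" where
  "g a = of_nat k * (1 + a) + of_nat l * (inverse a ^ (M + 1) * (1 + inverse a)\<^sup>2)"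

text \<open>
  The logarithmic derivative of \<open>(a + 1) (a^n + 1) / a^m\<close> produces the term \<open>n a^n / (a^n + 1)\<close>; its
  denominator is removed by the relation \<open>a^n + 1 = - a^m / (a + 1)\<close>.
\<close>
lemma derivative_at_root:
  assumes "a \<in> set as"
  shows "a * (a + 1) * poly (pderiv (root_poly as)) a = a ^ m * (1 + 2 * g a)"
proof -
  have a: "a \<noteq> 0"
    using root_nz assms by auto
  have "a * poly (pderiv (root_poly as)) a = of_nat m * (a * a ^ (m - 1)) + of_nat (n + 1) * a * a ^ n + of_nat n * (a * a ^ (n - 1)) + a"
    unfolding F by (simp add: pderiv_add pderiv_monom poly_monom algebra_simps)
  also have "a * a ^ (m - 1) = a ^ m"
    using m_eq by simp
  also have "a * a ^ (n - 1) = a ^ n"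
    using n_pos by (simp add: power_eq_if)
  finally have deriv: "a * poly (pderiv (root_poly as)) a =
      of_nat m * a ^ m + of_nat (n + 1) * a * a ^ n + of_nat n * a ^ n + a" .
  have "a ^ m * (inverse a ^ (M + 1) * (1 + inverse a)\<^sup>2) = a ^ n * (a ^ (M + 1) * inverse a ^ (M + 1)) * (a * (1 + inverse a))\<^sup>2"
    by (simp add: M_eq power_add power2_eq_square eval_nat_numeral mult_ac)
  also have "a ^ (M + 1) * inverse a ^ (M + 1) = 1"
    by (simp only: power_mult_distrib[symmetric] right_inverse[OF a] power_one)
  also have "a * (1 + inverse a) = a + 1"
    using a by (simp add: distrib_left)
  finally have c: "a ^ m * (inverse a ^ (M + 1) * (1 + inverse a)\<^sup>2) = a ^ n * (a + 1)\<^sup>2"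
    by simp
  have "a ^ m * (1 + 2 * g a) = a ^ m + 2 * of_nat k * (1 + a) * a ^ m
      + 2 * of_nat l * (a ^ m * (inverse a ^ (M + 1) * (1 + inverse a)\<^sup>2))"
    by (simp add: g_def algebra_simps)
  also have "\<dots> = a ^ m + 2 * of_nat k * (1 + a) * a ^ m + 2 * of_nat l * (a ^ n * (a + 1)\<^sup>2)"
    unfolding c ..
  finally have rhs: "a ^ m * (1 + 2 * g a) = a ^ m + 2 * of_nat k * (1 + a) * a ^ m + 2 * of_nat l * (a ^ n * (a + 1)\<^sup>2)" .
  have coeffs: "of_nat m = 2 * of_nat k + (1 :: complex)" "of_nat n = 2 * (of_nat l :: complex)"
      "of_nat (n + 1) = 2 * of_nat l + (1 :: complex)"
    using m_eq n_eq by simp_all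
  have "(a + 1) * ((2 * c + 1) * u + (2 * d + 1) * a * w + 2 * d * w + a) = u + 2 * c * (1 + a) * u + 2 * d * (w * (a + 1)\<^sup>2)"
    if "u + (a + 1) * (w + 1) = 0" for c d u w
    using that by algebra
  from this[OF assms[unfolded root_iff]]
  have "(a + 1) * (of_nat m * a ^ m + of_nat (n + 1) * a * a ^ n + of_nat n * a ^ n + a) =
      a ^ m + 2 * of_nat k * (1 + a) * a ^ m + 2 * of_nat l * (a ^ n * (a + 1)\<^sup>2)"
    unfolding coeffs .
  then show ?thesis
    unfolding rhs deriv[symmetric] by (simp add: mult_ac)
qed

lemma prod_derivatives: "(\<Prod>a\<leftarrow>as. poly (pderiv (root_poly as)) a) = (\<Prod>a\<leftarrow>as. 1 + 2 * g a)"
proof -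
  have "(\<Prod>a\<leftarrow>as. a * (a + 1) * poly (pderiv (root_poly as)) a) = (\<Prod>a\<leftarrow>as. a ^ m * (1 + 2 * g a))"
    by (intro arg_cong[of _ _ prod_list] map_cong derivative_at_root refl)
  then show ?thesis
    unfolding prod_list_mult prod_list_power prod_roots prod_roots_plus_1 using m_eq by simp
qed

text \<open>
  The roots are algebraic integers.
\<close>
lemma root_in_V2: "a \<in> set as \<Longrightarrow> a \<in> V2"
proof (rule V2.integral_closed)
  assume a: "a \<in> set as"
  define c where "c = (\<lambda>i. if i \<in> {0, 1, n, n + 1} then -1 else (0 :: complex))"
  show "c i \<in> V2" for i
    by (auto simp: c_def intro!: V2.closed)
  have "(\<Sum>i<m. c i * a ^ i) = (\<Sum>i\<in>{0, 1, n, n + 1}. c i * a ^ i)"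
    using M_eq n_le by (intro sum.mono_neutral_right) (auto simp: c_def)
  also have "\<dots> = - ((a + 1) * (a ^ n + 1))"
    using n_pos n_eq by (auto simp: c_def algebra_simps)
  also have "\<dots> = a ^ m"
    using a[unfolded root_iff, folded eq_neg_iff_add_eq_0] by (rule sym)
  finally show "a ^ m = (\<Sum>i<m. c i * a ^ i)" ..
qed

lemma inverse_root_in_V2: "a \<in> set as \<Longrightarrow> inverse a \<in> V2"
  by (rule V2.inverse_closed_of_prod(1)[of as "\<lambda>a. a"]) (auto intro: root_in_V2 simp only: prod_roots, simp)

lemma pair_sum_unit:
  assumes "(x, y) \<in> set (pairs as)"
  shows "x + y \<noteq> 0 \<and> inverse (x + y) \<in> V2"
proof -
  have "(case p of (x, y) \<Rightarrow> x + y) \<in> V2" if "p \<in> set (pairs as)" for p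
    using that set_pairs[of "fst p" "snd p" as]
    by (simp add: case_prod_unfold V2.add_closed root_in_V2)
  from V2.inverse_closed_of_prod[of "pairs as" "\<lambda>(x, y). x + y", OF this prod_pair_sums assms]
  show ?thesis by simp
qed

lemma g_in_V2: "a \<in> set as \<Longrightarrow> g a \<in> V2"
  unfolding g_def by (intro V2.closed root_in_V2 inverse_root_in_V2)

text \<open>
  Both sides compute the discriminant up to sign: from the differences of the roots, which bring in the
  sum over pairs, and from the derivatives at the roots, which bring in \<open>g\<close>. The sign \<open>(-1) ^ k\<close> stems
  from the \<open>m (m - 1) / 2\<close> pairs.
\<close>
lemma discriminant_mod_8:
  "\<exists>v\<in>V2. 4 * (\<Sum>(x, y)\<leftarrow>pairs as. x * y / (x + y)\<^sup>2) =
     1 - (-1) ^ k * (1 + 2 * (\<Sum>a\<leftarrow>as. g a) + 2 * ((\<Sum>a\<leftarrow>as. g a)\<^sup>2 - (\<Sum>a\<leftarrow>as. (g a)\<^sup>2))) + 8 * v"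
proof -
  define b where "b = (\<lambda>(x :: complex, y). x * y / (x + y)\<^sup>2)"
  have b: "b p \<in> V2" if "p \<in> set (pairs as)" for p
  proof -
    obtain x y where p: "p = (x, y)" by force
    have "x \<in> V2" "y \<in> V2"
      using that set_pairs[of x y as] root_in_V2 unfolding p by blast+
    moreover have "inverse (x + y) \<in> V2"
      using that pair_sum_unit unfolding p by auto
    moreover have "b p = x * y * inverse (x + y) ^ 2"
      by (simp add: b_def p divide_inverse power_inverse)
    ultimately show ?thesis
      by (auto intro!: V2.mult_closed V2.power_closed)
  qed
  obtain v where v: "v \<in> V2" "(\<Prod>p\<leftarrow>pairs as. 1 - 4 * b p) = 1 - 4 * (\<Sum>p\<leftarrow>pairs as. b p) + 8 * v"
    using V2.prod_1_minus_4[of "pairs as" b] b by auto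
  obtain w where w: "w \<in> V2" "(\<Prod>a\<leftarrow>as. 1 + 2 * g a) =
      1 + 2 * (\<Sum>a\<leftarrow>as. g a) + 2 * ((\<Sum>a\<leftarrow>as. g a)\<^sup>2 - (\<Sum>a\<leftarrow>as. (g a)\<^sup>2)) + 8 * w"
    using V2.prod_1_plus_2[of as g] g_in_V2 by auto
  have pair: "- ((x - y)\<^sup>2) = - 1 * ((x + y) ^ 2 * (1 - 4 * b (x, y)))" if "(x, y) \<in> set (pairs as)" for x y
  proof -
    have "x + y \<noteq> 0"
      using pair_sum_unit[OF that] by auto
    then have "(x + y) ^ 2 * (1 - 4 * b (x, y)) = (x + y)\<^sup>2 - 4 * (x * y)"
      by (simp add: b_def right_diff_distrib)
    then show ?thesis
      by (simp add: power2_eq_square algebra_simps)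
  qed
  have len: "even (length (pairs as)) \<longleftrightarrow> even k"
  proof -
    have "2 * length (pairs as) + m = m * m"
      using length_pairs[of as] by (simp add: length_as)
    then have "length (pairs as) = k * (2 * k + 1)"
      unfolding m_eq by (simp add: algebra_simps)
    then show ?thesis by simp
  qed
  have "(\<Prod>(x, y)\<leftarrow>pairs as. - ((x - y)\<^sup>2)) = (\<Prod>(x, y)\<leftarrow>pairs as. - 1 * ((x + y) ^ 2 * (1 - 4 * b (x, y))))"
    by (intro arg_cong[of _ _ prod_list] map_case_prod_cong pair)
  also have "\<dots> = (\<Prod>p\<leftarrow>pairs as. - 1) * ((\<Prod>(x, y)\<leftarrow>pairs as. x + y)\<^sup>2 * (\<Prod>p\<leftarrow>pairs as. 1 - 4 * b p))"
    unfolding prod_list_mult[symmetric] prod_list_power[symmetric] by (simp add: case_prod_unfold)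
  also have "(\<Prod>p\<leftarrow>pairs as. - 1) = (-1 :: complex) ^ k"
    using len by (simp add: map_replicate_const) (metis minus_one_power_iff)
  finally have "(\<Prod>a\<leftarrow>as. 1 + 2 * g a) = (-1) ^ k * (1 - 4 * (\<Sum>p\<leftarrow>pairs as. b p) + 8 * v)"
    unfolding prod_pderiv_root_poly[symmetric] prod_derivatives prod_pair_sums v by simp
  then have "(-1) ^ k * (\<Prod>a\<leftarrow>as. 1 + 2 * g a) = 1 - 4 * (\<Sum>p\<leftarrow>pairs as. b p) + 8 * v"
    by (simp add: minus_one_power_iff)
  then have "4 * (\<Sum>p\<leftarrow>pairs as. b p) =
      1 - (-1) ^ k * (1 + 2 * (\<Sum>a\<leftarrow>as. g a) + 2 * ((\<Sum>a\<leftarrow>as. g a)\<^sup>2 - (\<Sum>a\<leftarrow>as. (g a)\<^sup>2))) + 8 * (v - (-1) ^ k * w)"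
    unfolding w by (simp add: algebra_simps)
  moreover have "v - (-1) ^ k * w \<in> V2"
    using v w by (intro V2.closed)
  ultimately show ?thesis
    unfolding b_def by blast
qed

end


section \<open>The power sums that occur\<close>

lemma psi_recurrence:
  "even n \<Longrightarrow> n > 0 \<Longrightarrow> psi n j + psi n (j + 1) + psi n (j + n) + psi n (j + n + 1) = 0"
proof -
  assume n: "even n" "n > 0"
  have "psi n (i + n) = 2 * (-1) ^ i - psi n i" for i
    using n by (simp add: psi_def power_add)
  from this[of j] this[of "j + 1"] show ?thesis
    by (simp add: add_ac)
qed

context pentanomial_roots
begin

lemma inverse_power_sum: "0 < j \<Longrightarrow> j < 2 * m \<Longrightarrow> (\<Sum>a\<leftarrow>as. inverse a ^ j) = of_int (rho m n j)"
  by (rule power_sums_of_inverses[OF F]) (use n_eq n_pos M_eq in auto)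

text \<open>
  Multiplying the equation of a root by \<open>1 / a^(m - i)\<close> expresses \<open>a^i\<close> by four inverse powers with
  exponents below \<open>m\<close>, where the power sums obey the recurrence of \<open>psi\<close>.
\<close>
lemma power_sum_small:
  assumes i: "0 < i" "i \<le> 2"
  shows "(\<Sum>a\<leftarrow>as. a ^ i) = 0"
proof -
  define j where "j = M + 2 - i"
  have n2: "n \<ge> 2"
    using n_eq n_pos by auto
  then have j: "0 < j" "j + n + 1 < m" "m = (j + n + 1) + i"
    using i M_eq n_le by (auto simp: j_def)
  have "a ^ i = - 1 * (inverse a ^ j + inverse a ^ (j + 1) + inverse a ^ (j + n) + inverse a ^ (j + n + 1))"
    if a: "a \<in> set as" for a
  proof -
    have nz: "a \<noteq> 0"
      using root_nz a by auto
    have split: "inverse a ^ (j + n + 1) * a ^ (n + 1) = inverse a ^ j"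
        "inverse a ^ (j + n + 1) * a ^ n = inverse a ^ (j + 1)"
        "inverse a ^ (j + n + 1) * a = inverse a ^ (j + n)"
        "inverse a ^ (j + n + 1) * a ^ m = a ^ i"
      using power_mult_inverse_power[OF nz, of "n + 1" "j + n + 1"] power_mult_inverse_power[OF nz, of n "j + n + 1"]
        power_mult_inverse_power[OF nz, of 1 "j + n + 1"]
        power_mult_inverse_power[of "inverse a" "j + n + 1" m] nz j
      by (simp_all add: mult_ac)
    have "inverse a ^ (j + n + 1) * (a ^ m + (a ^ (n + 1) + a ^ n + a + 1)) = 0"
      using a unfolding root_iff by (simp add: algebra_simps)
    then have "a ^ i + (inverse a ^ j + inverse a ^ (j + 1) + inverse a ^ (j + n) + inverse a ^ (j + n + 1)) = 0"
      unfolding distrib_left split by simp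
    then show ?thesis
      unfolding mult_minus_left mult_1_left eq_neg_iff_add_eq_0 .
  qed
  then have "(\<Sum>a\<leftarrow>as. a ^ i) =
      (\<Sum>a\<leftarrow>as. - 1 * (inverse a ^ j + inverse a ^ (j + 1) + inverse a ^ (j + n) + inverse a ^ (j + n + 1)))"
    by (intro arg_cong[of _ _ sum_list] map_cong) auto
  also have "\<dots> = - 1 * of_int (rho m n j + rho m n (j + 1) + rho m n (j + n) + rho m n (j + n + 1))"
  proof -
    have "(\<Sum>a\<leftarrow>as. inverse a ^ j) = of_int (rho m n j)"
      "(\<Sum>a\<leftarrow>as. inverse a ^ (j + 1)) = of_int (rho m n (j + 1))"
      "(\<Sum>a\<leftarrow>as. inverse a ^ (j + n)) = of_int (rho m n (j + n))"
      "(\<Sum>a\<leftarrow>as. inverse a ^ (j + n + 1)) = of_int (rho m n (j + n + 1))"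
      by (rule inverse_power_sum; use j(1,2) in linarith)+
    then show ?thesis
      unfolding sum_list_const_mult sum_list_addf of_int_add by (simp only:)
  qed
  also have "rho m n j + rho m n (j + 1) + rho m n (j + n) + rho m n (j + n + 1) = 0"
    using j psi_recurrence[of n j] n_eq n_pos by (simp add: rho_def)
  finally show ?thesis by simp
qed

text \<open>
  The sums of \<open>g a\<close> and of \<open>(g a)\<^sup>2\<close> over the roots are \<open>s_sum\<close> and \<open>q_sum\<close>, by the expansions of
  \<open>a^(-M-1) (1 + 1/a)\<^sup>2\<close>, \<open>a^(-M) (1 + 1/a)^3\<close> and \<open>a^(-2M-2) (1 + 1/a)^4\<close>.
\<close>
definition s_sum :: int where
  "s_sum = int k * int m + int l * (rho m n (M + 1) + 2 * rho m n (M + 2) + rho m n (M + 3))"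

definition C_sum :: int where
  "C_sum = rho m n (2 * M + 2) + 4 * rho m n (2 * M + 3) + 6 * rho m n (2 * M + 4)
    + 4 * rho m n (2 * M + 5) + rho m n (2 * M + 6)"

definition q_sum :: int where
  "q_sum = int k * int k * int m
    + 2 * int k * int l * (rho m n M + 3 * rho m n (M + 1) + 3 * rho m n (M + 2) + rho m n (M + 3))
    + int l * int l * C_sum"

lemma sum_one: "(\<Sum>a\<leftarrow>as. 1) = (of_nat m :: complex)"
  by (simp add: length_as sum_list_triv)

lemma sum_g: "(\<Sum>a\<leftarrow>as. g a) = of_int s_sum"
proof -
  have "g a = of_nat k * 1 + of_nat k * a ^ 1 + of_nat l * (inverse a ^ (M + 1) + 2 * inverse a ^ (M + 2) + inverse a ^ (M + 3))" for a
    by (simp add: g_def power_add power2_eq_square eval_nat_numeral algebra_simps)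
  then have "(\<Sum>a\<leftarrow>as. g a) = (\<Sum>a\<leftarrow>as. of_nat k * 1 + of_nat k * a ^ 1 + of_nat l * (inverse a ^ (M + 1) + 2 * inverse a ^ (M + 2) + inverse a ^ (M + 3)))"
    by simp
  also have "\<dots> = of_int s_sum"
  proof -
    have sums: "(\<Sum>a\<leftarrow>as. inverse a ^ (M + 1)) = of_int (rho m n (M + 1))"
      "(\<Sum>a\<leftarrow>as. inverse a ^ (M + 2)) = of_int (rho m n (M + 2))"
      "(\<Sum>a\<leftarrow>as. inverse a ^ (M + 3)) = of_int (rho m n (M + 3))"
      by (rule inverse_power_sum; use M_eq in linarith)+
    show ?thesis
      unfolding sum_list_addf sum_list_const_mult sums sum_one s_sum_def
      using power_sum_small[of 1] by simp
  qed
  finally show ?thesis .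
qed

lemma sum_g_square: "(\<Sum>a\<leftarrow>as. (g a)\<^sup>2) = of_int q_sum"
proof -
  have "(g a)\<^sup>2 = of_nat k * of_nat k * (1 + 2 * a ^ 1 + a ^ 2)
      + 2 * of_nat k * of_nat l * (inverse a ^ M + 3 * inverse a ^ (M + 1) + 3 * inverse a ^ (M + 2) + inverse a ^ (M + 3))
      + of_nat l * of_nat l * (inverse a ^ (2 * M + 2) + 4 * inverse a ^ (2 * M + 3) + 6 * inverse a ^ (2 * M + 4)
        + 4 * inverse a ^ (2 * M + 5) + inverse a ^ (2 * M + 6))"
    if a: "a \<in> set as" for a
  proof -
    define y where "y = inverse a"
    define u where "u = y ^ M"
    have ay: "a * y = 1"
      using root_nz a by (simp add: y_def)
    have powers: "y ^ (M + 1) = u * y" "y ^ (M + 2) = u * y\<^sup>2" "y ^ (M + 3) = u * y ^ 3"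
      "y ^ (2 * M + 2) = u * u * y\<^sup>2" "y ^ (2 * M + 3) = u * u * y ^ 3" "y ^ (2 * M + 4) = u * u * y ^ 4"
      "y ^ (2 * M + 5) = u * u * y ^ 5" "y ^ (2 * M + 6) = u * u * y ^ 6"
      by (simp_all only: u_def power_add mult_2 power_one_right)
    have "(c * (1 + a) + d * (u * y * (1 + y)\<^sup>2))\<^sup>2 =
      c * c * (1 + 2 * a + a\<^sup>2)
      + 2 * c * d * (u + 3 * (u * y) + 3 * (u * y\<^sup>2) + u * y ^ 3)
      + d * d * (u * u * y\<^sup>2 + 4 * (u * u * y ^ 3) + 6 * (u * u * y ^ 4) + 4 * (u * u * y ^ 5) + u * u * y ^ 6)" for c d
      using ay by algebra
    then show ?thesis
      unfolding g_def y_def[symmetric] powers power_one_right u_def[symmetric] .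
  qed
  then have "(\<Sum>a\<leftarrow>as. (g a)\<^sup>2) = (\<Sum>a\<leftarrow>as. of_nat k * of_nat k * (1 + 2 * a ^ 1 + a ^ 2)
      + 2 * of_nat k * of_nat l * (inverse a ^ M + 3 * inverse a ^ (M + 1) + 3 * inverse a ^ (M + 2) + inverse a ^ (M + 3))
      + of_nat l * of_nat l * (inverse a ^ (2 * M + 2) + 4 * inverse a ^ (2 * M + 3) + 6 * inverse a ^ (2 * M + 4)
        + 4 * inverse a ^ (2 * M + 5) + inverse a ^ (2 * M + 6)))"
    by (intro arg_cong[of _ _ sum_list] map_cong) auto
  also have "\<dots> = of_int q_sum"
  proof -
    have sums: "(\<Sum>a\<leftarrow>as. inverse a ^ M) = of_int (rho m n M)"
      "(\<Sum>a\<leftarrow>as. inverse a ^ (M + 1)) = of_int (rho m n (M + 1))"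
      "(\<Sum>a\<leftarrow>as. inverse a ^ (M + 2)) = of_int (rho m n (M + 2))"
      "(\<Sum>a\<leftarrow>as. inverse a ^ (M + 3)) = of_int (rho m n (M + 3))"
      "(\<Sum>a\<leftarrow>as. inverse a ^ (2 * M + 2)) = of_int (rho m n (2 * M + 2))"
      "(\<Sum>a\<leftarrow>as. inverse a ^ (2 * M + 3)) = of_int (rho m n (2 * M + 3))"
      "(\<Sum>a\<leftarrow>as. inverse a ^ (2 * M + 4)) = of_int (rho m n (2 * M + 4))"
      "(\<Sum>a\<leftarrow>as. inverse a ^ (2 * M + 5)) = of_int (rho m n (2 * M + 5))"
      "(\<Sum>a\<leftarrow>as. inverse a ^ (2 * M + 6)) = of_int (rho m n (2 * M + 6))"
      by (rule inverse_power_sum; use M_eq n_pos n_le in linarith)+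
    show ?thesis
      unfolding sum_list_addf sum_list_const_mult sums sum_one q_sum_def C_sum_def
      using power_sum_small[of 1] power_sum_small[of 2] by simp
  qed
  finally show ?thesis .
qed

lemma M_even: "even M"
  using M_eq m_eq n_eq by presburger

lemma rho_low: "j < m \<Longrightarrow> rho m n j = psi n j"
  by (simp add: rho_def)

lemma odd_psi: "odd (psi n j)"
  using n_eq by (auto simp: psi_def)

lemma C1_mod_4: "4 dvd rho m n (M + 1) + 2 * rho m n (M + 2) + rho m n (M + 3)"
proof -
  have "\<not> n dvd i" if "odd i" for i
    using that n_eq dvd_trans[of 2 n i] by auto
  then have "\<not> n dvd M + 1" "\<not> n dvd M + 3"
    using M_even by simp_all
  then have "psi n (M + 1) = -1" "psi n (M + 3) = -1"
    using M_even by (simp_all add: psi_def)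
  moreover have "\<exists>e. psi n (M + 2) = 1 + 2 * (int l * e)"
    using M_even n_eq by (auto simp: psi_def intro: exI[of _ 0])
  moreover have "rho m n (M + 1) = psi n (M + 1)" "rho m n (M + 2) = psi n (M + 2)" "rho m n (M + 3) = psi n (M + 3)"
    by (rule rho_low; use M_eq n_pos in linarith)+
  ultimately show ?thesis
    by auto
qed

lemma C11_even: "even (rho m n M + 3 * rho m n (M + 1) + 3 * rho m n (M + 2) + rho m n (M + 3))"
proof -
  have "rho m n M = psi n M" "rho m n (M + 1) = psi n (M + 1)" "rho m n (M + 2) = psi n (M + 2)" "rho m n (M + 3) = psi n (M + 3)"
    by (rule rho_low; use M_eq n_pos in linarith)+
  then show ?thesis
    using odd_psi by (simp del: add_2_eq_Suc')
qed

text \<open>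
  Modulo \<open>4\<close>, the first sum is \<open>k m\<close> and the second is \<open>k\<^sup>2 m + l\<^sup>2 C\<close>. The remaining terms in \<open>k\<close>
  collapse because \<open>k (k + 1)\<close> is even.
\<close>
lemma discriminant_value_mod_8:
  "8 dvd (1 + 2 * s_sum + 2 * (s_sum\<^sup>2 - q_sum)) - (int m - 2 * int l * int l * C_sum)"
proof -
  obtain c where c: "rho m n (M + 1) + 2 * rho m n (M + 2) + rho m n (M + 3) = 4 * c"
    using C1_mod_4 by (elim dvdE)
  obtain d where d: "rho m n M + 3 * rho m n (M + 1) + 3 * rho m n (M + 2) + rho m n (M + 3) = 2 * d"
    using C11_even by (elim dvdE)
  have "even (int k * (int k + 1))"
    by simp
  then obtain e where e: "int k * (int k + 1) = 2 * e"
    by (elim dvdE)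
  have m: "int m = 2 * int k + 1"
    using m_eq by simp
  have "(1 + 2 * s_sum + 2 * (s_sum\<^sup>2 - q_sum)) - (int m - 2 * int l * int l * C_sum) =
      8 * (int l * c + 2 * int k * int m * int l * c + 4 * int l * int l * c * c - int k * int l * d
        + int k * e + int k ^ 4)"
    unfolding s_sum_def q_sum_def c d m using e by algebra
  then show ?thesis
    by (rule dvdI)
qed

text \<open>
  \<open>D\<close> agrees with the discriminant modulo \<open>8\<close>, so this is Stickelberger's criterion for odd degree: the
  number of factors is odd exactly if the discriminant is \<open>1\<close> modulo \<open>8\<close>.
\<close>
lemma parity_criterion:
  assumes f: "embed_poly f = root_poly as"
    and D: "D = (-1) ^ k * (int m - 2 * int l * int l * C_sum)" and D4: "D mod 4 = 1"
  shows "even (num_irreducible_factors f) \<longleftrightarrow> D mod 8 = 5"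
proof -
  define I where "I = 1 + 2 * s_sum + 2 * (s_sum\<^sup>2 - q_sum)"
  have "8 dvd (-1) ^ k * (I - (int m - 2 * int l * int l * C_sum))"
    unfolding I_def using discriminant_value_mod_8 by (rule dvd_mult)
  then have "8 dvd (-1) ^ k * I - D"
    unfolding D by (simp add: right_diff_distrib)
  then obtain e where e: "(-1) ^ k * I = D + 8 * e"
    by (metis add.commute diff_add_cancel dvdE)
  have "4 dvd 1 - D"
    using D4 by presburger
  then obtain c where c: "1 - D = 4 * c"
    by (elim dvdE)
  obtain v where v: "v \<in> V2" "4 * (\<Sum>(x, y)\<leftarrow>pairs as. x * y / (x + y)\<^sup>2) =
      1 - (-1) ^ k * (1 + 2 * of_int s_sum + 2 * ((of_int s_sum)\<^sup>2 - of_int q_sum)) + 8 * v"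
    using discriminant_mod_8 unfolding sum_g sum_g_square by blast
  have "1 - (-1) ^ k * (1 + 2 * of_int s_sum + 2 * ((of_int s_sum)\<^sup>2 - of_int q_sum)) = (of_int (1 - (-1) ^ k * I) :: complex)"
    by (simp add: I_def)
  also have "1 - (-1) ^ k * I = 4 * (c - 2 * e)"
    unfolding e using c by simp
  finally have "4 * (\<Sum>(x, y)\<leftarrow>pairs as. x * y / (x + y)\<^sup>2) = 4 * (of_int (c - 2 * e) + 2 * v)"
    unfolding v(2) by simp
  then have "(\<Sum>(x, y)\<leftarrow>pairs as. x * y / (x + y)\<^sup>2) = of_int (c - 2 * e) + 2 * v"
    unfolding mult_cancel_left by simp
  then have "even (degree f + num_irreducible_factors f) \<longleftrightarrow> even (c - 2 * e)"
    using f v(1) root_in_V2 pair_sum_unit by (intro parity_from_complex_roots) auto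
  moreover have "degree f = m"
    using f length_as by (metis degree_embed_poly degree_root_poly)
  moreover have "odd c \<longleftrightarrow> D mod 8 = 5"
    using c by presburger
  ultimately show ?thesis
    using m_eq by auto
qed

text \<open>
  Both \<open>n\<close> and \<open>j\<close> are \<open>2\<close> modulo \<open>4\<close>, and there \<open>2\<close> and \<open>-2\<close> agree, so the signs in \<open>psi\<close> and \<open>rho\<close>
  disappear.
\<close>
lemma rho_mod_4:
  assumes j: "j = 2 * u" "odd u" and l: "odd l"
  shows "rho m n j mod 4 = (1 + 2 * of_bool (n dvd j) + 2 * of_bool (m \<le> j \<and> even ((j - m) div n))) mod 4"
proof -
  have two: "(x * (-1) ^ i) mod 4 = 2" if "x mod 4 = 2" for x :: int and i :: nat
    using that by (cases "even i") (auto; presburger)+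
  have "(int n * (-1) ^ (j div n)) mod 4 = 2" "(int j * (-1) ^ (j - m)) mod 4 = 2"
    by (rule two, use j l n_eq in presburger)+
  moreover have "(1 + (if P then x else 0) - (if Q then y else 0)) mod 4 = (1 + 2 * of_bool P + 2 * of_bool Q) mod 4"
    if "x mod 4 = 2" "y mod 4 = 2" for x y :: int and P Q
    using that by (cases P; cases Q) (simp_all only: if_True if_False of_bool_eq, presburger+)
  ultimately show ?thesis
    unfolding rho_def psi_def using j by simp
qed

lemma C_sum_mod_4:
  assumes l: "odd l"
  shows "C_sum mod 4 = 2 * (of_bool (n dvd 2 * M + 2) + of_bool (n dvd 2 * M + 6)
    + of_bool (m \<le> 2 * M + 2 \<and> even ((2 * M + 2 - m) div n))
    + of_bool (m \<le> 2 * M + 6 \<and> even ((2 * M + 6 - m) div n))) mod 4"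
proof -
  have "odd (rho m n (2 * M + 4))"
    using odd_psi[of "2 * M + 4"] by (auto simp: rho_def)
  moreover have "rho m n (2 * M + 2) mod 4 = (1 + 2 * of_bool (n dvd 2 * M + 2)
      + 2 * of_bool (m \<le> 2 * M + 2 \<and> even ((2 * M + 2 - m) div n))) mod 4"
    using M_even l by (intro rho_mod_4[of _ "M + 1"]) auto
  moreover have "rho m n (2 * M + 6) mod 4 = (1 + 2 * of_bool (n dvd 2 * M + 6)
      + 2 * of_bool (m \<le> 2 * M + 6 \<and> even ((2 * M + 6 - m) div n))) mod 4"
    using M_even l by (intro rho_mod_4[of _ "M + 3"]) auto
  moreover have "(x + 4 * p + 6 * y + 4 * q + z) mod 4 = 2 * (a + b + c + d) mod 4"
    if "odd y" "x mod 4 = (1 + 2 * a + 2 * c) mod 4" "z mod 4 = (1 + 2 * b + 2 * d) mod 4"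
    for a b c d p q x y z :: int
  proof -
    from that obtain e1 e2 e3 where "y = 2 * e1 + 1" "x - (1 + 2 * a + 2 * c) = 4 * e2" "z - (1 + 2 * b + 2 * d) = 4 * e3"
      unfolding mod_eq_dvd_iff by (elim oddE dvdE)
    then have "(x + 4 * p + 6 * y + 4 * q + z) - 2 * (a + b + c + d) = 4 * (p + 3 * e1 + q + e2 + e3 + 2)"
      by simp
    then show ?thesis
      unfolding mod_eq_dvd_iff by (rule dvdI)
  qed
  ultimately show ?thesis
    unfolding C_sum_def by blast
qed

end


section \<open>The dependence on the remainder of 2 m\<close>

text \<open>
  With \<open>r = M mod n\<close>, an even number, the two divisibilities say \<open>r = l - 1\<close> and \<open>r = l - 3\<close>. The two
  quotients are equal or consecutive; their parities differ exactly if \<open>r = 0\<close> or \<open>r = n - 2\<close>, where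
  \<open>m > 2 M + 2\<close> counts as the quotient \<open>-1\<close>. These four values of \<open>r\<close> belong to the remainders \<open>4, 0, 6, 2\<close> of \<open>2 m\<close>. For \<open>n = 6\<close> the values
  \<open>l - 3\<close> and \<open>0\<close> coincide and cancel, which is why \<open>n = 6\<close> is exceptional.
\<close>
lemma residue_count_parity:
  fixes m n l M :: nat
  assumes l: "odd l" "l \<ge> 3" and n: "n = 2 * l" and m: "m = n + M + 3" and M: "even M" "n \<le> M"
  shows "odd (of_bool (n dvd 2 * M + 2) + of_bool (n dvd 2 * M + 6)
      + of_bool (m \<le> 2 * M + 2 \<and> even ((2 * M + 2 - m) div n))
      + of_bool (m \<le> 2 * M + 6 \<and> even ((2 * M + 6 - m) div n)) :: int)
    \<longleftrightarrow> (if n = 6 then 2 * m mod n \<noteq> 0 else 2 * m mod n \<le> 6)"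
proof -
  obtain t where t: "M div n = Suc t"
    using M l n by (metis div_greater_zero_iff gr0_implies_Suc not_numeral_le_zero mult_eq_0_iff gr0I zero_neq_numeral)
  define r where "r = M mod n"
  have Mt: "M = n * t + n + r"
    using t div_mult_mod_eq[of M n] by (simp add: r_def algebra_simps)
  have "even (n * t + n)"
    using n by simp
  then have r: "r < n" "even r"
    using M(1) l n unfolding Mt by (simp_all add: r_def)
  have l_dvd: "l dvd x \<longleftrightarrow> x = l" if "0 < x" "x < 2 * l" for x
    using that by (auto elim!: dvdE)
  have d1: "n dvd 2 * M + 2 \<longleftrightarrow> r + 1 = l"
  proof -
    have "2 * M + 2 = n * (2 * t + 2) + 2 * (r + 1)"
      by (simp add: Mt algebra_simps)
    then have "n dvd 2 * M + 2 \<longleftrightarrow> 2 * l dvd 2 * (r + 1)"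
      unfolding n by (metis dvd_add_right_iff dvd_triv_left)
    also have "\<dots> \<longleftrightarrow> l dvd r + 1"
      by (rule nat_mult_dvd_cancel1) simp
    also have "\<dots> \<longleftrightarrow> r + 1 = l"
    proof (cases "r + 1 = 2 * l")
      case True
      then have False using r by presburger
      then show ?thesis ..
    next
      case False
      then show ?thesis using r n by (intro l_dvd) auto
    qed
    finally show ?thesis .
  qed
  have d3: "n dvd 2 * M + 6 \<longleftrightarrow> r + 3 = l"
  proof -
    have "2 * M + 6 = n * (2 * t + 2) + 2 * (r + 3)"
      by (simp add: Mt algebra_simps)
    then have "n dvd 2 * M + 6 \<longleftrightarrow> 2 * l dvd 2 * (r + 3)"
      unfolding n by (metis dvd_add_right_iff dvd_triv_left)
    also have "\<dots> \<longleftrightarrow> l dvd r + 3"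
      by (rule nat_mult_dvd_cancel1) simp
    also have "\<dots> \<longleftrightarrow> r + 3 = l"
    proof (cases "r + 3 < 2 * l")
      case True
      then show ?thesis by (intro l_dvd) auto
    next
      case False
      then have "r + 3 = 2 * l + 1"
        using r n by presburger
      moreover have "\<not> l dvd 2 * l + 1"
        using l by (metis dvd_add_right_iff dvd_triv_right nat_dvd_1_iff_1 numeral_le_one_iff semiring_norm(70))
      ultimately have "\<not> l dvd r + 3" "r + 3 \<noteq> l"
        using l by (metis, linarith)
      then show ?thesis by blast
    qed
    finally show ?thesis .
  qed
  have e2: "(m \<le> 2 * M + 2 \<and> even ((2 * M + 2 - m) div n)) \<longleftrightarrow> (if r = 0 then odd t else even t)"
  proof (cases "r = 0")
    case True
    show ?thesis
    proof (cases t)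
      case 0
      then show ?thesis using True m Mt by simp
    next
      case (Suc t')
      then have "2 * M + 2 - m = n * t' + (n - 1)"
        using True m Mt n l by (simp add: algebra_simps)
      moreover have "(n * t' + (n - 1)) div n = t'"
        using n l by (intro div_nat_eqI) (auto simp: algebra_simps)
      ultimately show ?thesis
        using True Suc m Mt n l by (simp add: algebra_simps)
    qed
  next
    case False
    then have "2 * M + 2 - m = n * t + (r - 1)"
      using m Mt n l by (simp add: algebra_simps)
    moreover have "(n * t + (r - 1)) div n = t"
      using r by (intro div_nat_eqI) (auto simp: algebra_simps)
    ultimately show ?thesis
      using False m Mt by simp
  qed
  have "m \<le> 2 * M + 6"
    using m Mt by simp
  moreover have "(2 * M + 6 - m) div n = (if r = n - 2 then Suc t else t)"
  proof (cases "r = n - 2")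
    case True
    then have "2 * M + 6 - m = n * Suc t + 1"
      using m Mt n l by (simp add: algebra_simps)
    moreover have "(n * Suc t + 1) div n = Suc t"
      using n l by (intro div_nat_eqI) (auto simp: algebra_simps)
    ultimately show ?thesis
      unfolding if_P[OF True] by (simp only:)
  next
    case False
    have "r + 3 < n"
      using False r n l by presburger
    moreover have "2 * M + 6 - m = n * t + (r + 3)"
      using m Mt n l by (simp add: algebra_simps)
    moreover have "(n * t + (r + 3)) div n = t"
      using \<open>r + 3 < n\<close> by (intro div_nat_eqI) (auto simp: algebra_simps)
    ultimately show ?thesis
      unfolding if_not_P[OF False] by (simp only:)
  qed
  ultimately have e4: "(m \<le> 2 * M + 6 \<and> even ((2 * M + 6 - m) div n)) \<longleftrightarrow> (if r = n - 2 then odd t else even t)"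
    by simp
  have "2 * m = (2 * r + 6) + n * (2 * t + 4)"
    by (simp add: m Mt algebra_simps)
  then have "2 * m mod n = (2 * r + 6) mod n"
    by (metis mod_mult_self2)
  also have "\<dots> = (if r + 3 < l then 2 * r + 6 else if r + 3 < n then 2 * r + 6 - n else 2)"
  proof -
    have "r + 3 < n \<or> r + 3 = n + 1"
      using r n by presburger
    then consider "r + 3 < l" | "l \<le> r + 3" "r + 3 < n" | "r + 3 = n + 1"
      by linarith
    then show ?thesis
    proof cases
      case 1
      then have "2 * r + 6 < n" using n by simp
      with 1 show ?thesis by simp
    next
      case 2
      then have "(2 * r + 6) mod n = (2 * r + 6 - n) mod n"
        using n by (intro le_mod_geq) simp
      also have "\<dots> = 2 * r + 6 - n"
        using 2 n by (intro mod_less) simp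
      finally have "(2 * r + 6) mod n = 2 * r + 6 - n" .
      with 2 show ?thesis by (simp only: not_less[symmetric] if_True if_False)
    next
      case 3
      then have "2 * r + 6 = 2 + n * 2" by simp
      then have "(2 * r + 6) mod n = 2 mod n"
        by (metis mod_mult_self2)
      also have "\<dots> = 2"
        using n l by simp
      finally have "(2 * r + 6) mod n = 2" .
      moreover have "\<not> r + 3 < l" "\<not> r + 3 < n"
        using 3 n by simp_all
      ultimately show ?thesis by (simp only: if_False)
    qed
  qed
  finally have mm: "2 * m mod n = (if r + 3 < l then 2 * r + 6 else if r + 3 < n then 2 * r + 6 - n else 2)" .
  have parity: "odd (of_bool a + of_bool b + of_bool c + of_bool d :: int) \<longleftrightarrow> ((a \<noteq> b) \<noteq> (c \<noteq> d))" for a b c d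
    by (cases a; cases b; cases c; cases d) simp_all
  have t_free: "((if r = 0 then odd t else even t) \<noteq> (if r = n - 2 then odd t else even t)) \<longleftrightarrow> ((r = 0) \<noteq> (r = n - 2))"
    by auto
  have "r + 3 < n \<or> r + 3 = n + 1"
    using r n by presburger
  then consider "r + 3 < l" | "l \<le> r + 3" "r + 3 < n" | "r + 3 = n + 1"
    by linarith
  then have "(((r + 1 = l) \<noteq> (r + 3 = l)) \<noteq> ((r = 0) \<noteq> (r = n - 2))) \<longleftrightarrow>
      (if n = 6 then 2 * m mod n \<noteq> 0 else 2 * m mod n \<le> 6)"
  proof cases
    case 1
    then have "2 * m mod n = 2 * r + 6" "r + 1 \<noteq> l" "r + 3 \<noteq> l" "r \<noteq> n - 2" "n \<noteq> 6"
      using mm n l by auto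
    then show ?thesis by simp
  next
    case 2
    then have mod: "2 * m mod n = 2 * r + 6 - n" "r \<noteq> n - 2"
      using mm by auto
    show ?thesis
    proof (cases "l = 3")
      case True
      then have "r = 0 \<or> r = 2"
        using 2 n r by presburger
      then show ?thesis
        using mod True n by auto
    next
      case False
      then have "l \<ge> 5" "r \<noteq> 0" "n \<noteq> 6"
        using 2 l n by presburger+
      moreover have "(r + 1 = l) \<noteq> (r + 3 = l) \<longleftrightarrow> 2 * r + 6 - n \<le> 6"
        using 2 n r l by presburger
      ultimately show ?thesis
        using mod by simp
    qed
  next
    case 3
    then have mod: "2 * m mod n = 2" and "r + 1 \<noteq> l" "r + 3 \<noteq> l" "r = n - 2" "r \<noteq> 0"
      using mm n l by auto
    then show ?thesis
      unfolding mod by simp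
  qed
  then show ?thesis
    unfolding parity d1 d3 e2 e4 t_free .
qed


section \<open>The parity of the number of irreducible factors\<close>

lemma signed_odd_mod_8:
  "((-1) ^ k * (2 * int k + 1)) mod 8 = (if (2 * k + 1) mod 8 \<in> {1, 7} then 1 else 5)"
proof -
  define q j where "q = k div 4" and "j = k mod 4"
  have k: "k = j + 4 * q"
    by (simp add: q_def j_def)
  have "2 * k + 1 = (2 * j + 1) + 8 * q" "2 * int k + 1 = (2 * int j + 1) + 8 * int q"
      "- (2 * int k + 1) = - (2 * int j + 1) + 8 * (- int q)"
    by (simp_all add: k)
  then have "(2 * k + 1) mod 8 = (2 * j + 1) mod 8" "(2 * int k + 1) mod 8 = (2 * int j + 1) mod 8"
      "(- (2 * int k + 1)) mod 8 = (- (2 * int j + 1)) mod 8"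
    by (metis mod_mult_self2)+
  moreover have "even k \<longleftrightarrow> even j"
    by (simp add: k)
  moreover have "j < 4"
    by (simp add: j_def)
  then have "j = 0 \<or> j = 1 \<or> j = 2 \<or> j = 3"
    by linarith
  ultimately show ?thesis
    unfolding minus_one_power_iff by (elim disjE) (simp_all del: minus_add_distrib)
qed

lemma cong_8_iff:
  "[int m = 1] (mod 8) \<or> [int m = - 1] (mod 8) \<longleftrightarrow> m mod 8 \<in> {1, 7}"
  "[int m = 3] (mod 8) \<or> [int m = - 3] (mod 8) \<longleftrightarrow> m mod 8 \<in> {3, 5}"
proof -
  have "int m mod 8 = int c \<longleftrightarrow> m mod 8 = c" for c
    by (metis of_nat_eq_iff of_nat_numeral zmod_int)
  from this[of 1] this[of 7] this[of 3] this[of 5]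
  show "[int m = 1] (mod 8) \<or> [int m = - 1] (mod 8) \<longleftrightarrow> m mod 8 \<in> {1, 7}"
    "[int m = 3] (mod 8) \<or> [int m = - 3] (mod 8) \<longleftrightarrow> m mod 8 \<in> {3, 5}"
    unfolding cong_def by simp_all
qed

theorem theorem3p1:
  fixes m n :: nat and f :: "bit poly"
  assumes "m > 0" and "n > 0" and "even n" and "2 \<le> n" and "n \<le> m div 2 - 1"
    and "f = monom 1 m + monom 1 (n + 1) + monom 1 n + monom 1 1 + 1"
    and "odd m" and "n > 2"
  shows "even (num_irreducible_factors f) \<longleftrightarrow>
      ([n = 0] (mod 4) \<and> ([int m = 3] (mod 8) \<or> [int m = - 3] (mod 8)))
    \<or> (n \<noteq> 6 \<and> [n = 2] (mod 4) \<and>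
        ((2 * m mod n \<le> 6 \<and> ([int m = 1] (mod 8) \<or> [int m = - 1] (mod 8)))
         \<or> (2 * m mod n > 6 \<and> ([int m = 3] (mod 8) \<or> [int m = - 3] (mod 8)))))
    \<or> (n = 6 \<and>
        ((2 * m mod n = 0 \<and> ([int m = 3] (mod 8) \<or> [int m = - 3] (mod 8)))
         \<or> (2 * m mod n \<noteq> 0 \<and> ([int m = 1] (mod 8) \<or> [int m = - 1] (mod 8)))))"
proof -
  define F :: "complex poly" where "F = monom 1 m + monom 1 (n + 1) + monom 1 n + monom 1 1 + 1"
  have n_lt: "2 * n + 3 \<le> m"
    using assms by presburger
  have embed: "embed_poly f = F"
  proof (rule poly_eqI)
    fix i
    have "i = m \<or> i = n + 1 \<or> i = n \<or> i = 1 \<or> i = 0 \<or> i \<notin> {m, n + 1, n, 1, 0}"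
      by auto
    then show "coeff (embed_poly f) i = coeff F i"
      using n_lt \<open>n > 2\<close> unfolding coeff_embed_poly assms(6) F_def by (auto simp: coeff_1)
  qed
  have lead: "lead_coeff F = 1" 
  proof -
    have "f \<noteq> 0"
    proof
      assume "f = 0"
      then have "coeff f 0 = 0" by simp
      then show False
        using n_lt \<open>n > 2\<close> unfolding assms(6) by simp
    qed
    then have "lead_coeff f = 1"
      using bit_not_zero_iff leading_coeff_neq_0 by blast
    then show ?thesis
      unfolding embed[symmetric] by simp
  qed
  then have "F \<noteq> 0" by auto
  then obtain A where A: "F = smult (lead_coeff F) (\<Prod>a\<in>#A. [:- a, 1:])"
    using alg_closed_imp_factorization by blast
  obtain as where "mset as = A"
    using ex_mset by blast
  then have roots: "F = root_poly as"
    using A lead unfolding root_poly_def by (metis mset_map prod_mset_prod_list smult_1_left)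
  define k l M where "k = m div 2" and "l = n div 2" and "M = m - n - 3"
  interpret pentanomial_roots m n k l M as
    by unfold_locales (use assms n_lt roots in \<open>auto simp: k_def l_def M_def F_def\<close>)
  define D where "D = (-1) ^ k * (int m - 2 * int l * int l * C_sum)"
  have "2 * int k + 1 = int m"
    using m_eq by simp
  from signed_odd_mod_8[of k, unfolded this, folded m_eq]
  have sm: "((-1) ^ k * int m) mod 8 = (if m mod 8 \<in> {1, 7} then 1 else 5)" .
  have m_cases: "m mod 8 \<in> {1, 7} \<longleftrightarrow> m mod 8 \<notin> {3, 5}"
    using \<open>odd m\<close> by simp presburger
  have D_eq: "D = (-1) ^ k * int m - 2 * (int l * int l * ((-1) ^ k * C_sum))"
    by (simp add: D_def algebra_simps)
  show ?thesis
  proof (cases "even l")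
    case True
    then obtain e where "int l * int l = 4 * e"
      by (elim evenE) (simp add: mult_ac)
    then have "D mod 8 = ((-1) ^ k * int m) mod 8"
      unfolding D_eq mod_eq_dvd_iff by (simp add: mult_ac)
    then have D: "D mod 8 = (if m mod 8 \<in> {1, 7} then 1 else 5)"
      unfolding sm .
    then have "D mod 8 = 1 \<or> D mod 8 = 5"
      by metis
    then have "D mod 4 = 1"
      by presburger
    then have "even (num_irreducible_factors f) \<longleftrightarrow> D mod 8 = 5"
      using parity_criterion[of f D] embed roots D_def by simp
    moreover have "[n = 0] (mod 4)" "\<not> [n = 2] (mod 4)" "n \<noteq> 6"
      unfolding cong_def using True n_eq by presburger+
    ultimately show ?thesis
      unfolding cong_8_iff using D m_cases by auto
  next
    case False
    have l: "odd l" "l \<ge> 3"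
      using False \<open>n > 2\<close> n_eq by presburger+
    \<comment> \<open>the condition on \<open>2 m mod n\<close> under which half of \<open>C_sum\<close> turns out to be odd\<close>
    define X where "X \<longleftrightarrow> (if n = 6 then 2 * m mod n \<noteq> 0 else 2 * m mod n \<le> 6)"
    obtain z where z: "C_sum mod 4 = 2 * z mod 4" and odd_z: "odd z \<longleftrightarrow> X"
      using C_sum_mod_4[OF l(1)] residue_count_parity[OF l n_eq M_eq M_even n_le] unfolding X_def by blast
    obtain w where w: "int l * int l = 4 * w + 1"
    proof -
      from l(1) obtain i where "l = 2 * i + 1" by (elim oddE)
      then have "int l * int l = 4 * (int i * int i + int i) + 1"
        by (simp add: algebra_simps)
      then show ?thesis by (rule that)
    qed
    have "\<exists>y. C_sum = 2 * y \<and> (odd y \<longleftrightarrow> X)"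
    proof -
      have "even C_sum" "odd (C_sum div 2) \<longleftrightarrow> odd z"
        using z by presburger+
      then show ?thesis
        using odd_z by (intro exI[of _ "C_sum div 2"]) auto
    qed
    then obtain y where y: "C_sum = 2 * y" "odd y \<longleftrightarrow> X"
      by blast
    define y' where "y' = (4 * w + 1) * ((-1) ^ k * y)"
    have odd_y': "odd y' \<longleftrightarrow> X"
      using y(2) by (simp add: y'_def)
    have D_y': "D = (-1) ^ k * int m - 4 * y'"
      unfolding D_eq w y(1) y'_def by simp
    have D8: "D mod 8 = (if m mod 8 \<in> {1, 7} \<longleftrightarrow> X then 5 else 1)"
    proof -
      have "(u - 4 * y') mod 8 = (if u mod 8 = 1 \<longleftrightarrow> odd y' then 5 else 1)" if "u mod 8 = 1 \<or> u mod 8 = 5" for u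
        using that by presburger
      from this[of "(-1) ^ k * int m"] show ?thesis
        unfolding D_y' odd_y' sm by (simp split: if_splits)
    qed
    then have "D mod 8 = 1 \<or> D mod 8 = 5"
      by metis
    then have "D mod 4 = 1"
      by presburger
    then have "even (num_irreducible_factors f) \<longleftrightarrow> D mod 8 = 5"
      using parity_criterion[of f D] embed roots D_def by simp
    also have "\<dots> \<longleftrightarrow> (m mod 8 \<in> {1, 7} \<longleftrightarrow> X)"
      unfolding D8 by simp
    finally have main: "even (num_irreducible_factors f) \<longleftrightarrow> (m mod 8 \<in> {1, 7} \<longleftrightarrow> X)" .
    moreover have "\<not> [n = 0] (mod 4)" "[n = 2] (mod 4)"
      unfolding cong_def using l(1) n_eq by presburger+
    ultimately show ?thesis
      unfolding cong_8_iff main X_def using m_cases by (cases "n = 6") (auto simp: not_less)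
  qed
qed

end
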